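(* Fix real numbers $R, L \ge 0$ and a stochastic process $\varphi = (\varphi(1), \varphi(2), \ldots)$ with $\varphi(i) = (\varphi_i^{(x)}, \varphi_i^{(y)}) \in \{0,1\} \times \{0,1\}$. For real $\varepsilon > 0$ put $\delta_1 = \varepsilon L$ and $\delta_2 = \varepsilon R$, and assume $\delta_1, \delta_2 \in (0,1)$. Fix $r \in \mathbb{R}$, $t \in \mathbb{R}_{>0}$, and $x \in \mathbb{Z}$. Let $$p_\varepsilon(x; r) = \mathbb{P}_V\big[ \mathfrak{H}(x + \lfloor \varepsilon^{-1} t \rfloor, \lfloor \varepsilon^{-1} t \rfloor) \ge r \big],$$ where $\mathbb{P}_V$ is the probability under the stochastic six-vertex model $\mathcal{P}(\delta_1, \delta_2)$ with initial data $\varphi$ and $\mathfrak{H}$ is its current, and let $$p(x; r) = \mathbb{P}_A\big[ J_t(x) \ge r \big],$$ where $\mathbb{P}_A$ is the probability under the ASEP with left jump rate $L$, right jump rate $R$, and initial data $\varphi$, and $J_t(x)$ is its current. Then $\lim_{\varepsilon \to 0} p_\varepsilon(x; r) = p(x; r)$.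
   Context: ASEP. The ASEP with left rate $L$ and right rate $R$ is the continuous-time Markov process of particles on $\mathbb{Z}$, at most one per site, in which each particle attempts to jump one step left at rate $L$ and one step right at rate $R$ (all exponential clocks independent); a jump is performed if and only if the destination is unoccupied. It is defined with infinitely many particles by the graphical construction: independent Poisson processes of rates $R$ and $L$ on $(0,\infty)$ are attached to each site $i$; at a point of the rate-$R$ (resp. rate-$L$) process of site $i$, a particle at $i$ (if there is one) attempts to jump to $i+1$ (resp. $i-1$). For any fixed time horizon, almost surely $\mathbb{Z}$ splits into finite intervals that do not interact, so the process is well defined. ASEP with initial data $\varphi$: site $i \ge 1$ is initially occupied iff $\varphi_i^{(x)} = 1$; site $i \le 0$ is initially occupied iff $\varphi_{1-i}^{(y)} = 1$. The randomness of the dynamics is independent of $\varphi$. Particles are tagged in increasing order so that $X_{-1}(0) \le 0 < X_0(0)$, and $X_i(t)$ is the position of particle $i$ at time $t$. The current is the almost surely finite sum, over all particles $i$, $$J_t(x) = \sum_{i} \big( \mathbf{1}_{X_i(0) \le 0} \mathbf{1}_{X_i(t) > x} - \mathbf{1}_{X_i(0) > 0} \mathbf{1}_{X_i(t) \le x} \big).$$ Stochastic six-vertex model. A six-vertex directed path ensemble is a family of up-right directed lattice paths in $\mathbb{Z}_{>0}^2$, each entering from the $y$-axis or the $x$-axis, with no two sharing an edge (they may share vertices). With initial data $\varphi$: a path enters $(1,t)$ from the left (from $(0,t)$) iff $\varphi_t^{(y)} = 1$, and a path enters $(t,1)$ from below (from $(t,0)$) iff $\varphi_t^{(x)} = 1$.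 The measure $\mathcal{P}(\delta_1, \delta_2)$ is obtained by processing vertices along successive diagonals $x+y = 2, 3, \ldots$: given the incoming arrows at a vertex, the outgoing arrows are chosen, independently over vertices, as follows. No incoming path: no outgoing path. Only a path from below: it exits upward with probability $\delta_1$, to the right with probability $1-\delta_1$. Only a path from the left: it exits to the right with probability $\delta_2$, upward with probability $1-\delta_2$. Two incoming paths: two outgoing paths, one upward and one to the right, and the paths touch without crossing (the path from the left exits upward, the path from below exits to the right). Current of the six-vertex model. Color a path red if it emanates from the $x$-axis and blue if it emanates from the $y$-axis. For $Y$ a positive integer and real $X > 0$, $\mathfrak{H}(X,Y)$ is the number of blue paths that intersect the line $y = Y$ to the right of $(X,Y)$ minus the number of red paths that intersect the line $y=Y$ at or to the left of $(X,Y)$, where the intersection of a path with the line $y = Y$ is taken to be the vertex $(p, Y)$ at which the path leaves that line upward (to $(p,Y+1)$). The quantity $p_\varepsilon(x;r)$ is considered for $\varepsilon$ small enough that $\lfloor \varepsilon^{-1}t\rfloor \ge 1$ and $x + \lfloor \varepsilon^{-1}t\rfloor > 0$. *)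

theory Defs
  imports "HOL-Probability.Probability"
begin

text \<open>
  Initial data: the pair \<open>\<phi> k\<close> is \<open>(\<phi>\<^sub>k\<^sup>x, \<phi>\<^sub>k\<^sup>y)\<close>, indexed by \<open>k \<ge> 1\<close>.
  A stochastic process \<open>\<phi>\<close> enters only through its law, a probability measure on \<open>data_space\<close>.
\<close>

definition data_space :: "(nat \<Rightarrow> bool \<times> bool) measure" where
  "data_space = PiM {1..} (\<lambda>_. count_space UNIV)"


text \<open>
  A path is identified by its entry point: \<open>From_x k\<close> enters \<open>(k, 1)\<close> from below and
  \<open>From_y k\<close> enters \<open>(1, k)\<close> from the left. Since no two paths share an edge, an ensemble
  is given by the map sending each edge to the path that uses it, if any.
\<close>

datatype path = From_x nat | From_y nat

text \<open>
  \<open>vertex_out c below left = (up, right)\<close>. The component \<open>fst c\<close> (resp. \<open>snd c\<close>) is the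
  event that a path which is alone in coming from below (resp. from the left) goes straight.
\<close>

fun vertex_out :: "bool \<times> bool \<Rightarrow> path option \<Rightarrow> path option \<Rightarrow> path option \<times> path option" where
  "vertex_out c None None = (None, None)"
| "vertex_out c (Some p) None = (if fst c then (Some p, None) else (None, Some p))"
| "vertex_out c None (Some q) = (if snd c then (None, Some q) else (Some q, None))"
| "vertex_out c (Some p) (Some q) = (Some q, Some p)"

text \<open>
  \<open>six_vertex_out \<phi> c x y\<close> gives the paths on the edges from \<open>(x, y)\<close> to \<open>(x, y + 1)\<close> and
  to \<open>(x + 1, y)\<close>, where the points with \<open>x = 0\<close> or \<open>y = 0\<close> carry the boundary data.
\<close>

fun six_vertex_out ::
  "(nat \<Rightarrow> bool \<times> bool) \<Rightarrow> (nat \<times> nat \<Rightarrow> bool \<times> bool) \<Rightarrow> nat \<Rightarrow> nat \<Rightarrow> path option \<times> path option"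
where
  "six_vertex_out \<phi> c (Suc x) 0 = (if fst (\<phi> (Suc x)) then Some (From_x (Suc x)) else None, None)"
| "six_vertex_out \<phi> c 0 (Suc y) = (None, if snd (\<phi> (Suc y)) then Some (From_y (Suc y)) else None)"
| "six_vertex_out \<phi> c 0 0 = (None, None)"
| "six_vertex_out \<phi> c (Suc x) (Suc y) =
     vertex_out (c (Suc x, Suc y))
       (fst (six_vertex_out \<phi> c (Suc x) y)) (snd (six_vertex_out \<phi> c x (Suc y)))"

definition six_vertex ::
  "real \<Rightarrow> real \<Rightarrow> (nat \<Rightarrow> bool \<times> bool) measure
    \<Rightarrow> ((nat \<Rightarrow> bool \<times> bool) \<times> (nat \<times> nat \<Rightarrow> bool \<times> bool)) measure" where
  "six_vertex \<delta>1 \<delta>2 \<Phi> =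
     \<Phi> \<Otimes>\<^sub>M PiM ({1..} \<times> {1..}) (\<lambda>_. measure_pmf (pair_pmf (bernoulli_pmf \<delta>1) (bernoulli_pmf \<delta>2)))"

text \<open>A path leaves the line \<open>y = Y\<close> upward at most once; one that never does is not counted.\<close>

definition six_vertex_current ::
  "(nat \<Rightarrow> bool \<times> bool) \<times> (nat \<times> nat \<Rightarrow> bool \<times> bool) \<Rightarrow> real \<Rightarrow> nat \<Rightarrow> int" where
  "six_vertex_current \<omega> X Y =
     int (card {k. \<exists>p. real p > X \<and> fst (six_vertex_out (fst \<omega>) (snd \<omega>) p Y) = Some (From_y k)}) -
     int (card {k. \<exists>p. real p \<le> X \<and> fst (six_vertex_out (fst \<omega>) (snd \<omega>) p Y) = Some (From_x k)})"


text \<open>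
  A Poisson process is given as the random set \<open>N\<close> of its points. The counts are described by the
  explicit Poisson probabilities since \<open>poisson_pmf\<close> is only usable for positive rates; for
  rate \<open>0\<close> they say that there are almost surely no points.
\<close>

definition poisson_process :: "'w measure \<Rightarrow> real \<Rightarrow> ('w \<Rightarrow> real set) \<Rightarrow> bool" where
  "poisson_process M \<rho> N \<longleftrightarrow>
     (AE \<omega> in M. N \<omega> \<subseteq> {0<..} \<and> (\<forall>b. finite (N \<omega> \<inter> {0<..b}))) \<and>
     (\<forall>a b. 0 \<le> a \<longrightarrow> a \<le> b \<longrightarrow>
        (\<lambda>\<omega>. card (N \<omega> \<inter> {a<..b})) \<in> measurable M (count_space UNIV) \<and>
        (\<forall>k. measure M {\<omega> \<in> space M. card (N \<omega> \<inter> {a<..b}) = k} =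
               (\<rho> * (b - a)) ^ k / fact k * exp (- (\<rho> * (b - a))))) \<and>
     (\<forall>s :: nat \<Rightarrow> real. 0 \<le> s 0 \<longrightarrow> mono s \<longrightarrow>
        prob_space.indep_vars M (\<lambda>_. count_space UNIV)
          (\<lambda>k \<omega>. card (N \<omega> \<inter> {s k<..s (Suc k)})) UNIV)"

datatype direction = Leftward | Rightward

definition initially_occupied :: "(nat \<Rightarrow> bool \<times> bool) \<Rightarrow> int \<Rightarrow> bool" where
  "initially_occupied \<phi> y = (if y \<ge> 1 then fst (\<phi> (nat y)) else snd (\<phi> (nat (1 - y))))"

text \<open>
  The tag of the particle that is initially at \<open>y\<close>: tags increase with the position, consecutive
  particles have consecutive tags, and the first particle to the right of \<open>0\<close> has tag \<open>0\<close>.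
  If there are only finitely many particles on one side, the remaining tags there are unused.
\<close>

definition particle_tag :: "(int \<Rightarrow> bool) \<Rightarrow> int \<Rightarrow> int" where
  "particle_tag occ y =
     (if 0 < y then int (card {z. 0 < z \<and> z < y \<and> occ z})
      else - 1 - int (card {z. y < z \<and> z \<le> 0 \<and> occ z}))"

text \<open>
  Trajectories are functions \<open>X\<close>, with \<open>X i s = Some y\<close> if the particle tagged \<open>i\<close> is at \<open>y\<close> at
  time \<open>s\<close>, and \<open>X i s = None\<close> if the tag \<open>i\<close> is unused.
\<close>

definition occupied_before :: "(int \<Rightarrow> real \<Rightarrow> int option) \<Rightarrow> real \<Rightarrow> int \<Rightarrow> bool" where
  "occupied_before X s y \<longleftrightarrow> (\<exists>j. \<forall>\<^sub>F u in at_left s. X j u = Some y)"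

definition jump :: "(direction \<times> int \<Rightarrow> real set) \<Rightarrow> real \<Rightarrow> (int \<Rightarrow> bool) \<Rightarrow> int \<Rightarrow> int" where
  "jump N s occ y =
     (if s \<in> N (Rightward, y) \<and> \<not> occ (y + 1) then y + 1
      else if s \<in> N (Leftward, y) \<and> \<not> occ (y - 1) then y - 1
      else y)"

text \<open>
  The trajectories are right-continuous step functions with left limits, and their value at a time
  \<open>s\<close> arises from the left limits at \<open>s\<close> by the attempted jumps at time \<open>s\<close>. The
  order of the cases in \<open>jump\<close> is immaterial, as almost surely no two clocks ring simultaneously.
\<close>

definition graphical_asep ::
  "(direction \<times> int \<Rightarrow> real set) \<Rightarrow> (int \<Rightarrow> bool) \<Rightarrow> (int \<Rightarrow> real \<Rightarrow> int option) \<Rightarrow> bool" where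
  "graphical_asep N occ X \<longleftrightarrow>
     (\<forall>i y. X i 0 = Some y \<longleftrightarrow> occ y \<and> particle_tag occ y = i) \<and>
     (\<forall>i. \<forall>s\<ge>0. \<forall>\<^sub>F u in at_right s. X i u = X i s) \<and>
     (\<forall>i. \<forall>s>0. \<exists>q. (\<forall>\<^sub>F u in at_left s. X i u = q) \<and>
        X i s = map_option (jump N s (occupied_before X s)) q)"

abbreviation count_path_space :: "(real \<Rightarrow> nat) measure" where
  "count_path_space \<equiv> PiM {0..} (\<lambda>_. count_space UNIV)"

definition count_path :: "real set \<Rightarrow> real \<Rightarrow> nat" where
  "count_path S = (\<lambda>s\<in>{0..}. card (S \<inter> {0<..s}))"

text \<open>
  A realization of the ASEP with left rate \<open>L\<close>, right rate \<open>R\<close> and initial data \<open>\<phi>\<close> of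
  law \<open>\<Phi>\<close>, on a probability space \<open>M\<close>. As sets of clock points, the \<open>N\<close> are almost surely
  determined by their counting functions, so independence is stated for the latter.
\<close>

locale asep = prob_space M
  for M :: "'w measure" and L R :: real and \<Phi> :: "(nat \<Rightarrow> bool \<times> bool) measure"
    and \<phi> :: "'w \<Rightarrow> nat \<Rightarrow> bool \<times> bool"
    and N :: "direction \<times> int \<Rightarrow> 'w \<Rightarrow> real set"
    and X :: "int \<Rightarrow> real \<Rightarrow> 'w \<Rightarrow> int option" +
  assumes initial_measurable: "\<phi> \<in> measurable M data_space"
    and initial_law: "distr M data_space \<phi> = \<Phi>"
    and left_clocks: "\<And>y. poisson_process M L (N (Leftward, y))"
    and right_clocks: "\<And>y. poisson_process M R (N (Rightward, y))"
    and clocks_indep: "indep_vars (\<lambda>_. count_path_space) (\<lambda>c \<omega>. count_path (N c \<omega>)) UNIV"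
    and initial_indep:
      "indep_set (sets (vimage_algebra (space M) \<phi> data_space))
         (sets (vimage_algebra (space M) (\<lambda>\<omega> c. count_path (N c \<omega>))
           (PiM UNIV (\<lambda>_. count_path_space))))"
    and position_measurable: "\<And>i s. 0 \<le> s \<Longrightarrow> X i s \<in> measurable M (count_space UNIV)"
    and evolution:
      "AE \<omega> in M. graphical_asep (\<lambda>c. N c \<omega>) (initially_occupied (\<phi> \<omega>)) (\<lambda>i s. X i s \<omega>)"

definition asep_current :: "(int \<Rightarrow> real \<Rightarrow> int option) \<Rightarrow> real \<Rightarrow> int \<Rightarrow> real" where
  "asep_current X t x =
     (\<Sum>\<^sub>\<infinity>i\<in>{i. X i 0 \<noteq> None}.
        of_bool (the (X i 0) \<le> 0) * of_bool (the (X i t) > x) -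
        of_bool (the (X i 0) > 0) * of_bool (the (X i t) \<le> x))"

end

theory Submission
  imports Defs "HOL-Real_Asymp.Real_Asymp"
begin

text \<open>
  The theorem holds because both models can be driven by the same Poisson clocks, in such a way that
  almost surely their currents coincide for all small \<open>\<epsilon>\<close>.

  \<^bold>\<open>The six-vertex model in a moving frame.\<close> Identify the vertex \<open>(p, k)\<close> with the bond between the
  sites \<open>z = p - k\<close> and \<open>z + 1\<close> of the integers. In this frame a path that climbs the typical
  staircase (up, right, up, right, ...) stands still, and the local rule at a vertex becomes an
  attempted exclusion jump over the bond: the coin for a path from below is an attempt from \<open>z + 1\<close>
  to \<open>z\<close>, the coin for a path from the left is an attempt from \<open>z\<close> to \<open>z + 1\<close>, and two touching
  paths mean a blocked jump. Row \<open>k\<close> of the model is one sweep over all bonds from left to right,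
  and the data on the two axes become the occupation variables of the ASEP. This is the lemma
  \<open>row_sweep\<close>.

  \<^bold>\<open>The coupling.\<close> Cut the time axis of each clock into slots and let the coin of a bond in row \<open>k\<close>
  record whether the corresponding clock rings in its \<open>k\<close>-th slot. For a clock of rate \<open>\<rho>\<close> the slot
  width \<open>- ln (1 - \<rho> \<epsilon>) / \<rho>\<close> makes the probability of a ring exactly \<open>\<rho> \<epsilon>\<close>, so that the coins have
  precisely the law \<open>\<P>(\<epsilon> L, \<epsilon> R)\<close> (lemma \<open>distr_coupling\<close>). Left and right clocks have slots of
  different widths, but both widths are \<open>\<epsilon> (1 + o(1))\<close>.

  \<^bold>\<open>Agreement for small \<open>\<epsilon>\<close>.\<close> Almost surely there are bonds \<open>a\<close> far to the left and \<open>b\<close> far to the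
  right whose clocks are silent up to time \<open>t + 1\<close>. Nothing crosses these bonds in either model, so
  only the finitely many rings between them matter. These rings happen at distinct times, none of
  them at time \<open>t\<close>. Hence for small \<open>\<epsilon>\<close> they fall into distinct slots in the right order, those
  before \<open>t\<close> are exactly those with slot at most \<open>\<lfloor>t / \<epsilon>\<rfloor>\<close>, and both models perform the same jumps
  in the same order; the induction over the rows is \<open>row_matches_asep\<close> and its consequence for the
  currents is \<open>currents_agree\<close>. Almost sure agreement gives convergence of the probabilities by
  dominated convergence.
\<close>

section \<open>The six-vertex model as a sweep over bonds\<close>

text \<open>
  The path that the initial particle at site \<open>y\<close> becomes: the axes are unfolded into a line.
\<close>

definition path_from :: "int \<Rightarrow> path" where
  "path_from y = (if y \<ge> 1 then From_x (nat y) else From_y (nat (1 - y)))"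

lemma path_from_eq_iff [simp]: "path_from y = path_from y' \<longleftrightarrow> y = y'"
  by (auto simp: path_from_def split: if_splits)

lemma vertex_out_no_coins: "vertex_out (False, False) p q = (q, p)"
  by (cases p; cases q) auto

lemma vertex_out_subset:
  assumes "vertex_out d p q = (u, v)"
  shows "u = Some w \<Longrightarrow> p = Some w \<or> q = Some w" "v = Some w \<Longrightarrow> p = Some w \<or> q = Some w"
  using assms by (cases p; cases q; auto split: if_splits)+

definition initial_config :: "(nat \<Rightarrow> bool \<times> bool) \<Rightarrow> int \<Rightarrow> path option" where
  "initial_config \<phi> z = (if initially_occupied \<phi> z then Some (path_from z) else None)"

text \<open>
  Occupation of the site \<open>z\<close> after row \<open>k\<close>, in the frame in which row \<open>k\<close> is shifted by \<open>k\<close>. For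
  \<open>z \<le> - k\<close> the shifted column lies outside the quadrant; there the initial particle still waits
  for the row in which it enters.
\<close>

definition row_config where
  "row_config \<phi> c k z =
     (if z + int k \<ge> 1 then fst (six_vertex_out \<phi> c (nat (z + int k)) k) else initial_config \<phi> z)"

text \<open>
  The intermediate state of the sweep that turns row \<open>k\<close> into row \<open>k + 1\<close>: the occupant of the site
  \<open>z\<close> after the bond on its left and before the bond on its right has been updated. In the quadrant
  it is the path on a horizontal edge.
\<close>

definition row_carry where
  "row_carry \<phi> c k z =
     (if z + int k \<ge> 0 then snd (six_vertex_out \<phi> c (nat (z + int k)) (Suc k)) else initial_config \<phi> z)"

text \<open>
  The sweep starts at the bond \<open>- k\<close>; the bonds further to the left behave as if they had no coins.
\<close>

definition bond_coin :: "(nat \<times> nat \<Rightarrow> bool \<times> bool) \<Rightarrow> nat \<Rightarrow> int \<Rightarrow> bool \<times> bool" where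
  "bond_coin c k z = (if z + int k \<ge> 0 then c (nat (z + int k + 1), Suc k) else (False, False))"

lemma row_config_0: "row_config \<phi> c 0 z = initial_config \<phi> z"
proof (cases "z \<ge> 1")
  case True
  then have "nat z = Suc (nat (z - 1))" by simp
  with True show ?thesis
    by (simp add: row_config_def initial_config_def initially_occupied_def path_from_def)
qed (simp add: row_config_def)

text \<open>
  The rule at a vertex is an update of the bond between \<open>z\<close> and \<open>z + 1\<close>. The path from the left is
  what the sweep has left at \<open>z\<close>, the path from below is the old occupant of \<open>z + 1\<close>, the upward exit
  is the new occupant of \<open>z\<close>, and the exit to the right is handed over to the next bond.
\<close>

lemma row_sweep:
  "vertex_out (bond_coin c k z) (row_config \<phi> c k (z + 1)) (row_carry \<phi> c k z)
     = (row_config \<phi> c (Suc k) z, row_carry \<phi> c k (z + 1))"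
proof (cases "z + int k \<ge> 0")
  case True
  define n where "n = nat (z + int k)"
  have z: "z = int n - int k" using True by (simp add: n_def)
  have [simp]: "nat (int n + 1) = Suc n" "nat (1 + int n) = Suc n" by simp_all
  show ?thesis
    by (simp add: row_config_def row_carry_def bond_coin_def z)
next
  case False
  then show ?thesis
    by (cases "z = - 1 - int k")
      (auto simp: row_config_def row_carry_def bond_coin_def vertex_out_no_coins
         initial_config_def initially_occupied_def path_from_def nat_add_distrib)
qed

lemma row_sweep_quiet:
  assumes "bond_coin c k z = (False, False)"
  shows "row_config \<phi> c (Suc k) z = row_carry \<phi> c k z"
    and "row_carry \<phi> c k (z + 1) = row_config \<phi> c k (z + 1)"
  using row_sweep[of c k z \<phi>] assms by (simp_all add: vertex_out_no_coins)

lemma row_carry_left: "z \<le> - int k \<Longrightarrow> row_carry \<phi> c k z = row_config \<phi> c k z"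
  using row_sweep_quiet(2)[of c k "z - 1" \<phi>] by (simp add: bond_coin_def)

text \<open>
  Here \<open>y\<close> is the starting point of the path \<open>w\<close>, so if \<open>w\<close> is found at \<open>z\<close> this means that it has not
  crossed the bond between \<open>e\<close> and \<open>e + 1\<close>.
\<close>

definition same_side :: "(nat \<Rightarrow> bool \<times> bool) \<Rightarrow> int \<Rightarrow> path \<Rightarrow> int \<Rightarrow> bool" where
  "same_side \<phi> e w z \<longleftrightarrow> (\<exists>y. w = path_from y \<and> initially_occupied \<phi> y \<and> (y \<le> e \<longleftrightarrow> z \<le> e))"

text \<open>
  A bond without coins is a wall. The outputs of any other bond are among its inputs, which lie on
  the same side of the wall, so the claim propagates along each sweep and from row to row.
\<close>

lemma row_config_same_side:
  assumes "\<And>j. j < k \<Longrightarrow> bond_coin c j e = (False, False)"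
    and "row_config \<phi> c k z = Some w"
  shows "same_side \<phi> e w z"
  using assms
proof (induction k arbitrary: z w)
  case 0
  then show ?case
    by (auto simp: row_config_0 initial_config_def same_side_def split: if_splits)
next
  case (Suc k)
  have IH: "row_config \<phi> c k z = Some w \<Longrightarrow> same_side \<phi> e w z" for z w
    using Suc.IH Suc.prems(1) by simp
  have quiet: "bond_coin c k e = (False, False)"
    using Suc.prems(1) by simp
  have shift: "same_side \<phi> e w (z + 1) \<longleftrightarrow> same_side \<phi> e w z" if "z \<noteq> e" for w z
  proof -
    have "z + 1 \<le> e \<longleftrightarrow> z \<le> e" using that by linarith
    then show ?thesis unfolding same_side_def by simp
  qed
  have carry: "row_carry \<phi> c k z = Some w \<Longrightarrow> same_side \<phi> e w z" for z w
  proof (cases "z \<le> - int k")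
    case True
    then show "row_carry \<phi> c k z = Some w \<Longrightarrow> same_side \<phi> e w z"
      using IH row_carry_left by metis
  next
    case False
    then have "- int k \<le> z" by simp
    then show "row_carry \<phi> c k z = Some w \<Longrightarrow> same_side \<phi> e w z"
    proof (induction z arbitrary: w rule: int_ge_induct)
      case base
      then show ?case using IH row_carry_left by (metis order_refl)
    next
      case (step z)
      show ?case
      proof (cases "z = e")
        case True
        then show ?thesis using step.prems row_sweep_quiet(2)[OF quiet] IH by metis
      next
        case False
        then show ?thesis
          using vertex_out_subset(2)[OF row_sweep step.prems] step.IH IH shift by blast
      qed
    qed
  qed
  show ?case
  proof (cases "z = e")
    case True
    then show ?thesis using Suc.prems(2) row_sweep_quiet(1)[OF quiet] carry by metis
  next
    case False
    then show ?thesis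
      using vertex_out_subset(1)[OF row_sweep Suc.prems(2)] carry IH shift by blast
  qed
qed

lemma row_config_Suc_quiet:
  assumes "\<And>z. z \<in> {a..b} \<Longrightarrow> bond_coin c k z = (False, False)" and "z \<in> {a<..b}"
  shows "row_config \<phi> c (Suc k) z = row_config \<phi> c k z"
  using row_sweep_quiet(1)[of c k z \<phi>] row_sweep_quiet(2)[of c k "z - 1" \<phi>] assms by simp

text \<open>
  If only one bond of a stretch has coins, the sweep over the stretch amounts to the update of that
  bond, because no other bond moves the occupants that the sweep carries along.
\<close>

lemma row_config_Suc_single:
  assumes off: "\<And>z. z \<in> {a..b} \<Longrightarrow> z \<noteq> v \<Longrightarrow> bond_coin c k z = (False, False)"
    and v: "a < v" "v < b"
  shows "z \<in> {a<..b} \<Longrightarrow> z \<noteq> v \<Longrightarrow> z \<noteq> v + 1 \<Longrightarrow> row_config \<phi> c (Suc k) z = row_config \<phi> c k z"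
    and "(row_config \<phi> c (Suc k) v, row_config \<phi> c (Suc k) (v + 1))
         = vertex_out (bond_coin c k v) (row_config \<phi> c k (v + 1)) (row_config \<phi> c k v)"
proof -
  show "row_config \<phi> c (Suc k) z = row_config \<phi> c k z" if "z \<in> {a<..b}" "z \<noteq> v" "z \<noteq> v + 1"
    using row_sweep_quiet(1)[OF off, of z \<phi>] row_sweep_quiet(2)[OF off, of "z - 1" \<phi>] that by simp
  have "row_carry \<phi> c k v = row_config \<phi> c k v"
    using row_sweep_quiet(2)[OF off, of "v - 1" \<phi>] v by simp
  moreover have "row_config \<phi> c (Suc k) (v + 1) = row_carry \<phi> c k (v + 1)"
    using row_sweep_quiet(1)[OF off, of "v + 1" \<phi>] v by simp
  ultimately show "(row_config \<phi> c (Suc k) v, row_config \<phi> c (Suc k) (v + 1))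
         = vertex_out (bond_coin c k v) (row_config \<phi> c k (v + 1)) (row_config \<phi> c k v)"
    using row_sweep[of c k v \<phi>] by simp
qed

section \<open>Trajectories and current of the ASEP\<close>

text \<open>
  Induction along an interval: with \<open>m\<close> the supremum of the points up to which \<open>P\<close> holds, the step
  from the left gives \<open>P m\<close>, and the step to the right would go beyond \<open>m\<close> unless \<open>m = v\<close>.
\<close>

lemma real_induct:
  fixes P :: "real \<Rightarrow> bool"
  assumes "u \<le> v" and base: "P u"
    and right: "\<And>s. u \<le> s \<Longrightarrow> s < v \<Longrightarrow> P s \<Longrightarrow> \<forall>\<^sub>F r in at_right s. P r"
    and left: "\<And>s. u < s \<Longrightarrow> s \<le> v \<Longrightarrow> (\<And>r. u \<le> r \<Longrightarrow> r < s \<Longrightarrow> P r) \<Longrightarrow> P s"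
  shows "P v"
proof -
  define A where "A = {s \<in> {u..v}. \<forall>r \<in> {u..s}. P r}"
  define m where "m = Sup A"
  have uA: "u \<in> A" using assms(1) base by (auto simp: A_def)
  have bdd: "bdd_above A" by (rule bdd_aboveI[of _ v]) (auto simp: A_def)
  have um: "u \<le> m" using uA bdd by (auto simp: m_def intro: cSup_upper)
  have mv: "m \<le> v" unfolding m_def by (rule cSup_least) (use uA in \<open>auto simp: A_def\<close>)
  have below: "P r" if "u \<le> r" "r < m" for r
  proof -
    obtain s where "s \<in> A" "r < s" using \<open>r < m\<close> uA unfolding m_def
      by (metis empty_iff less_cSupE)
    then show ?thesis using that by (auto simp: A_def)
  qed
  have "P m"
  proof (cases "m = u")
    case False
    then show ?thesis using left[of m] um mv below by simp
  qed (use base in simp)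
  show ?thesis
  proof (cases "m = v")
    case False
    then obtain d where d: "d > m" "\<And>r. m < r \<Longrightarrow> r < d \<Longrightarrow> P r"
      using right[of m] um mv \<open>P m\<close> unfolding eventually_at_right_field by auto
    define s where "s = min v ((m + d) / 2)"
    have s: "m < s" "s < d" "s \<le> v" using d False mv by (auto simp: s_def min_def field_simps)
    have "P r" if "u \<le> r" "r \<le> s" for r
    proof -
      consider "r < m" | "r = m" | "m < r" by linarith
      then show ?thesis using d(2)[of r] s that below \<open>P m\<close> by cases auto
    qed
    then have "s \<in> A" using s um by (auto simp: A_def)
    then have "s \<le> m" using bdd by (auto simp: m_def intro: cSup_upper)
    with s show ?thesis by simp
  qed (use \<open>P m\<close> in simp)
qed

text \<open>
  Since trajectories are right-continuous step functions, a property of the position of a particle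
  can only be destroyed by a jump.
\<close>

lemma trajectory_induct:
  assumes graph: "graphical_asep N occ X"
    and uv: "0 \<le> u" "u \<le> v" and base: "P (X i u)"
    and step: "\<And>s q. u < s \<Longrightarrow> s \<le> v \<Longrightarrow> P q \<Longrightarrow> P (map_option (jump N s (occupied_before X s)) q)"
  shows "P (X i v)"
proof (rule real_induct[OF uv(2)])
  show "P (X i u)" by fact
next
  fix s assume s: "u \<le> s" "P (X i s)"
  have "\<forall>\<^sub>F r in at_right s. X i r = X i s"
    using graph s uv by (auto simp: graphical_asep_def)
  then show "\<forall>\<^sub>F r in at_right s. P (X i r)"
    by eventually_elim (use s in simp)
next
  fix s assume s: "u < s" "s \<le> v" and before: "\<And>r. u \<le> r \<Longrightarrow> r < s \<Longrightarrow> P (X i r)"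
  have "\<exists>q. (\<forall>\<^sub>F r in at_left s. X i r = q) \<and>
        X i s = map_option (jump N s (occupied_before X s)) q"
    using graph s uv by (simp add: graphical_asep_def)
  then obtain q where q: "\<forall>\<^sub>F r in at_left s. X i r = q"
    "X i s = map_option (jump N s (occupied_before X s)) q" by blast
  have "\<forall>\<^sub>F r in at_left s. r \<in> {u<..<s}"
    using eventually_at_left_real[OF s(1)] .
  with q(1) have "\<forall>\<^sub>F r in at_left s. P q"
    by eventually_elim (use before in force)
  then have "P q" by (simp add: eventually_const_iff)
  then show "P (X i s)" using step[OF s] q(2) by simp
qed

text \<open>
  The tags that contribute \<open>+ 1\<close> to the current, and below those that contribute \<open>- 1\<close>.
\<close>

definition right_crossers :: "(int \<Rightarrow> real \<Rightarrow> int option) \<Rightarrow> real \<Rightarrow> int \<Rightarrow> int set" where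
  "right_crossers X t x = {i. X i 0 \<noteq> None \<and> the (X i 0) \<le> 0 \<and> the (X i t) > x}"

definition left_crossers :: "(int \<Rightarrow> real \<Rightarrow> int option) \<Rightarrow> real \<Rightarrow> int \<Rightarrow> int set" where
  "left_crossers X t x = {i. X i 0 \<noteq> None \<and> the (X i 0) > 0 \<and> the (X i t) \<le> x}"

lemma not_summable_on_infinite_unit_support:
  fixes f :: "'a \<Rightarrow> real"
  assumes "infinite B" "B \<subseteq> A" "\<And>i. i \<in> B \<Longrightarrow> \<bar>f i\<bar> = 1"
  shows "\<not> f summable_on A"
proof
  assume "f summable_on A"
  then have "f summable_on B" using assms(2) by (rule summable_on_subset_banach)
  then have "(\<lambda>i. \<bar>f i\<bar>) summable_on B"
    using summable_on_iff_abs_summable_on_real[of f B] by simp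
  then have "(\<lambda>i. 1::real) summable_on B"
    using assms(3) summable_on_cong[of B "\<lambda>i. \<bar>f i\<bar>" "\<lambda>_. 1"] by simp
  then have bound: "real (card F) \<le> infsum (\<lambda>_. 1) B" if "finite F" "F \<subseteq> B" for F
    using finite_sum_le_infsum[of "\<lambda>_. 1::real" B F] that by simp
  obtain n where n: "infsum (\<lambda>_. 1::real) B < real n" using reals_Archimedean2 by blast
  obtain F where "finite F" "F \<subseteq> B" "card F = n"
    using infinite_arbitrarily_large[OF assms(1)] by blast
  then show False using bound n by fastforce
qed

text \<open>
  All nonzero terms of the current are \<open>\<plusminus> 1\<close>, so the infinite sum converges exactly if there are
  finitely many of them; otherwise it has the default value \<open>0\<close>.
\<close>

lemma asep_current_eq:
  "asep_current X t x =
     (if finite (right_crossers X t x \<union> left_crossers X t x)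
      then real (card (right_crossers X t x)) - real (card (left_crossers X t x)) else 0)"
proof -
  define R where "R = right_crossers X t x"
  define L where "L = left_crossers X t x"
  define g where "g = (\<lambda>i. indicator R i - indicator L i :: real)"
  have disj: "R \<inter> L = {}" by (auto simp: R_def L_def right_crossers_def left_crossers_def)
  have "asep_current X t x = infsum g {i. X i 0 \<noteq> None}"
    unfolding asep_current_def
    by (intro infsum_cong)
      (auto simp: g_def R_def L_def right_crossers_def left_crossers_def indicator_def)
  also have "\<dots> = infsum g (R \<union> L)"
    by (intro infsum_cong_neutral)
      (auto simp: g_def R_def L_def right_crossers_def left_crossers_def)
  also have "infsum g (R \<union> L) = (if finite (R \<union> L) then real (card R) - real (card L) else 0)"
  proof (cases "finite (R \<union> L)")
    case True
    then have "infsum g (R \<union> L) = (\<Sum>i \<in> R \<union> L. indicator R i) - (\<Sum>i \<in> R \<union> L. indicator L i)"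
      by (simp add: g_def sum_subtractf)
    also have "\<dots> = real (card R) - real (card L)"
      using True by (simp add: indicator_def sum.If_cases Int_absorb1 Int_Un_distrib2)
    finally show ?thesis using True by simp
  next
    case False
    have "\<not> g summable_on (R \<union> L)"
      by (rule not_summable_on_infinite_unit_support[OF False order_refl])
        (use disj in \<open>auto simp: g_def indicator_def\<close>)
    then have "infsum g (R \<union> L) = 0" by (rule infsum_not_exists)
    with False show ?thesis by (simp only: if_False)
  qed
  finally show ?thesis by (simp add: R_def L_def)
qed

section \<open>Agreement of the two models in a block between quiet bonds\<close>

lemma UNIV_direction: "UNIV = {Leftward, Rightward}"
  by (auto intro: direction.exhaust)

text \<open>
  The deterministic setting of the coupling, for one realization of the clocks. The number
  \<open>slot q s\<close> is the row in which a ring of the clock \<open>q\<close> at time \<open>s\<close> is used. Rings near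
  the block between the quiet bonds \<open>a\<close> and \<open>b\<close> are used in the order of their times, up to row \<open>Y\<close>
  exactly if they occur up to time \<open>t\<close>, and not before the sweeps have reached the block.
\<close>

locale block_coupling =
  fixes \<phi> :: "nat \<Rightarrow> bool \<times> bool"
    and N :: "direction \<times> int \<Rightarrow> real set"
    and X :: "int \<Rightarrow> real \<Rightarrow> int option"
    and c :: "nat \<times> nat \<Rightarrow> bool \<times> bool"
    and slot :: "direction \<times> int \<Rightarrow> real \<Rightarrow> nat"
    and a b x :: int and t :: real and Y :: nat
  assumes graph: "graphical_asep N (initially_occupied \<phi>) X"
    and t_nonneg: "0 \<le> t"
    and a_less_b: "a < b"
    and a_le: "a \<le> 0" "a \<le> x"
    and le_b: "0 \<le> b" "x \<le> b"
    and ring_pos: "\<And>q s. s \<in> N q \<Longrightarrow> 0 < s"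
    and ring_finite: "\<And>q s. finite (N q \<inter> {0<..s})"
    and ring_inj: "\<And>q q' s. s \<in> N q \<Longrightarrow> s \<in> N q' \<Longrightarrow> q = q'"
    and quiet: "\<And>e q s. e \<in> {a, b} \<Longrightarrow> q \<in> {(Rightward, e), (Leftward, e + 1)} \<Longrightarrow> s \<in> N q \<Longrightarrow> t < s"
    and slot_le_iff: "\<And>q s. snd q \<in> {a..b+1} \<Longrightarrow> s \<in> N q \<Longrightarrow> slot q s \<le> Y \<longleftrightarrow> s \<le> t"
    and slot_mono: "\<And>q q' s s'. snd q \<in> {a..b+1} \<Longrightarrow> snd q' \<in> {a..b+1} \<Longrightarrow> s \<in> N q \<Longrightarrow> s' \<in> N q' \<Longrightarrow>
           s < s' \<Longrightarrow> s' \<le> t \<Longrightarrow> slot q s < slot q' s'"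
    and slot_late: "\<And>q s. snd q \<in> {a..b+1} \<Longrightarrow> s \<in> N q \<Longrightarrow> s \<le> t \<Longrightarrow> - a < int (slot q s)"
    and coins: "\<And>m k. c (Suc m, Suc k) =
        (\<exists>s \<in> N (Leftward, int m - int k + 1). slot (Leftward, int m - int k + 1) s = Suc k,
         \<exists>s \<in> N (Rightward, int m - int k). slot (Rightward, int m - int k) s = Suc k)"
begin

abbreviation row :: "nat \<Rightarrow> int \<Rightarrow> path option" where
  "row \<equiv> row_config \<phi> c"

text \<open>
  The cut-off in \<open>bond_coin\<close> does no harm within the block, since no ring there is used in a row that
  starts to the right of \<open>a\<close>.
\<close>

lemma bond_coin_eq:
  assumes "z \<in> {a..b}" "k < Y"
  shows "bond_coin c k z =
     (\<exists>s \<in> N (Leftward, z + 1). slot (Leftward, z + 1) s = Suc k,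
      \<exists>s \<in> N (Rightward, z). slot (Rightward, z) s = Suc k)"
proof (cases "z + int k \<ge> 0")
  case True
  define m where "m = nat (z + int k)"
  have z: "z = int m - int k" using True by (simp add: m_def)
  have "nat (z + int k + 1) = Suc m" using True by (simp add: m_def)
  with True show ?thesis
    unfolding bond_coin_def by (simp add: coins z)
next
  case False
  have "slot q s \<noteq> Suc k" if "q \<in> {(Leftward, z + 1), (Rightward, z)}" "s \<in> N q" for q s
  proof
    assume eq: "slot q s = Suc k"
    have q: "snd q \<in> {a..b+1}" using that assms by auto
    have "s \<le> t" using slot_le_iff[OF q that(2)] eq assms by simp
    then show False using slot_late[OF q that(2)] eq assms False by simp
  qed
  with False show ?thesis by (auto simp: bond_coin_def)
qed

lemma bond_coin_quiet:
  assumes "e \<in> {a, b}" "k < Y"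
  shows "bond_coin c k e = (False, False)"
proof -
  have "slot q s \<noteq> Suc k" if "q \<in> {(Rightward, e), (Leftward, e + 1)}" "s \<in> N q" for q s
  proof -
    have "snd q \<in> {a..b+1}" using that assms a_less_b by auto
    then show ?thesis using quiet[OF assms(1) that] slot_le_iff[OF _ that(2)] assms by fastforce
  qed
  moreover have "e \<in> {a..b}" using assms a_less_b by auto
  ultimately show ?thesis using bond_coin_eq[of e k] assms by auto
qed

lemma row_same_side:
  assumes "k \<le> Y" "e \<in> {a, b}" "row k z = Some w"
  shows "same_side \<phi> e w z"
proof (rule row_config_same_side[OF _ assms(3)])
  show "bond_coin c j e = (False, False)" if "j < k" for j
    using bond_coin_quiet[OF assms(2)] assms(1) that by simp
qed

lemma unused_stays:
  assumes "X i 0 = None" "0 \<le> s"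
  shows "X i s = None"
  by (rule trajectory_induct[OF graph, of 0]) (use assms in auto)

lemma start_occupied: "X i 0 = Some y \<Longrightarrow> initially_occupied \<phi> y"
  using graph by (auto simp: graphical_asep_def)

lemma occupied_start: "initially_occupied \<phi> y \<Longrightarrow> \<exists>i. X i 0 = Some y"
  using graph by (auto simp: graphical_asep_def)

lemma particle_same_side:
  assumes "X i 0 = Some y" "0 \<le> s" "s \<le> t" "e \<in> {a, b}"
  shows "\<exists>z. X i s = Some z \<and> (z \<le> e \<longleftrightarrow> y \<le> e)"
proof (rule trajectory_induct[OF graph, of 0])
  fix r q assume r: "0 < r" "r \<le> s" and "\<exists>z. q = Some z \<and> (z \<le> e \<longleftrightarrow> y \<le> e)"
  then obtain z where z: "q = Some z" "z \<le> e \<longleftrightarrow> y \<le> e" by blast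
  have R: "r \<notin> N (Rightward, e)" and L: "r \<notin> N (Leftward, e + 1)"
    using quiet[OF assms(4), of _ r] r assms(3) by force+
  define f where "f = occupied_before X r"
  have "jump N r f z \<le> e \<longleftrightarrow> z \<le> e"
  proof (cases "z \<le> e")
    case True
    then have "z = e \<or> z + 1 \<le> e" by linarith
    then show ?thesis using R True by (auto simp: jump_def)
  next
    case False
    then have "z = e + 1 \<or> z > e + 1" by linarith
    then show ?thesis using L False by (auto simp: jump_def)
  qed
  then show "\<exists>z. map_option (jump N r (occupied_before X r)) q = Some z \<and> (z \<le> e \<longleftrightarrow> y \<le> e)"
    using z by (simp add: f_def)
qed (use assms in auto)

lemma block_confined:
  assumes "X i 0 = Some y" "0 \<le> s" "s \<le> t"
  obtains z where "X i s = Some z" "z \<in> {a<..b} \<longleftrightarrow> y \<in> {a<..b}"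
  using particle_same_side[OF assms, of a] particle_same_side[OF assms, of b] by fastforce

definition block_ring :: "real \<Rightarrow> bool" where
  "block_ring s \<longleftrightarrow> (\<exists>q. snd q \<in> {a<..b} \<and> s \<in> N q)"

lemma rests_between_rings:
  assumes uv: "0 \<le> u" "u \<le> v" and Xu: "X i u = Some z" "z \<in> {a<..b}"
    and none: "\<And>s. u < s \<Longrightarrow> s \<le> v \<Longrightarrow> \<not> block_ring s"
  shows "X i v = Some z"
proof (rule trajectory_induct[OF graph uv])
  fix s q assume s: "u < s" "s \<le> v" and q: "q = Some z"
  have "s \<notin> N (Rightward, z)" "s \<notin> N (Leftward, z)"
    using none[OF s] Xu(2) by (auto simp: block_ring_def)
  then show "map_option (jump N s (occupied_before X s)) q = Some z"
    by (simp add: q jump_def)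
qed fact

text \<open>
  Between two rings the configuration in the block is frozen, and whatever is seen in the block just
  before \<open>s\<close> has been in the block since \<open>u\<close>.
\<close>

lemma occupied_before_block:
  assumes us: "0 \<le> u" "u < s" "s \<le> t"
    and none: "\<And>r. u < r \<Longrightarrow> r < s \<Longrightarrow> \<not> block_ring r"
    and z: "z \<in> {a<..b}"
  shows "occupied_before X s z \<longleftrightarrow> (\<exists>j. X j u = Some z)"
proof
  have ev: "\<forall>\<^sub>F r in at_left s. r \<in> {u<..<s}"
    using eventually_at_left_real[OF us(2)] .
  {
    assume "occupied_before X s z"
    then obtain j where "\<forall>\<^sub>F r in at_left s. X j r = Some z" by (auto simp: occupied_before_def)
    from eventually_conj[OF this ev] obtain r where r: "X j r = Some z" "u < r" "r < s"
      using eventually_happens[of _ "at_left s"] by auto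
    obtain y where y: "X j 0 = Some y"
      using unused_stays[of j r] r us by (cases "X j 0") auto
    from y obtain z' where z': "X j r = Some z'" "z' \<in> {a<..b} \<longleftrightarrow> y \<in> {a<..b}"
      by (rule block_confined[where s = r]) (use us r in auto)
    from y obtain w where w: "X j u = Some w" "w \<in> {a<..b} \<longleftrightarrow> y \<in> {a<..b}"
      by (rule block_confined[where s = u]) (use us in auto)
    have "X j r = Some w"
      by (rule rests_between_rings[OF us(1) _ w(1)]) (use r w z z' none in auto)
    with r w show "\<exists>j. X j u = Some z" by auto
  }
  {
    assume "\<exists>j. X j u = Some z"
    then obtain j where j: "X j u = Some z" by blast
    from ev have "\<forall>\<^sub>F r in at_left s. X j r = Some z"
    proof eventually_elim
      case (elim r)
      then show ?case using rests_between_rings[OF us(1) _ j z] none by auto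
    qed
    then show "occupied_before X s z" by (auto simp: occupied_before_def)
  }
qed

lemma jump_at_ring:
  assumes us: "0 \<le> u" "u < s" "s \<le> t"
    and none: "\<And>r. u < r \<Longrightarrow> r < s \<Longrightarrow> \<not> block_ring r"
    and Xu: "X i u = Some z" "z \<in> {a<..b}"
  shows "X i s = Some (jump N s (\<lambda>w. \<exists>j. X j u = Some w) z)"
proof -
  have "\<exists>q. (\<forall>\<^sub>F r in at_left s. X i r = q) \<and>
        X i s = map_option (jump N s (occupied_before X s)) q"
    using graph us by (simp add: graphical_asep_def)
  then obtain q where q: "\<forall>\<^sub>F r in at_left s. X i r = q"
    "X i s = map_option (jump N s (occupied_before X s)) q" by blast
  have "\<forall>\<^sub>F r in at_left s. r \<in> {u<..<s}"
    using eventually_at_left_real[OF us(2)] .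
  then have "\<forall>\<^sub>F r in at_left s. X i r = Some z"
  proof eventually_elim
    case (elim r)
    then show ?case using rests_between_rings[OF us(1) _ Xu] none by auto
  qed
  with q(1) have "\<forall>\<^sub>F r in at_left s. q = Some z" by eventually_elim simp
  then have "q = Some z" by (simp add: eventually_const_iff)
  moreover have "jump N s (occupied_before X s) z = jump N s (\<lambda>w. \<exists>j. X j u = Some w) z"
  proof -
    have "z \<noteq> b" if "s \<in> N (Rightward, z)"
      using quiet[of b "(Rightward, b)" s] that us by auto
    moreover have "z \<noteq> a + 1" if "s \<in> N (Leftward, z)"
      using quiet[of a "(Leftward, a + 1)" s] that us by auto
    ultimately show ?thesis
      using Xu(2) occupied_before_block[OF us none] by (auto simp: jump_def)
  qed
  ultimately show ?thesis using q(2) by simp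
qed

lemma row_Suc_quiet:
  assumes "k < Y" and "\<And>q s. snd q \<in> {a<..b} \<Longrightarrow> s \<in> N q \<Longrightarrow> slot q s \<noteq> Suc k" and "z \<in> {a<..b}"
  shows "row (Suc k) z = row k z"
proof (rule row_config_Suc_quiet[OF _ assms(3)])
  fix z assume z: "z \<in> {a..b}"
  show "bond_coin c k z = (False, False)"
  proof (cases "z \<in> {a, b}")
    case True
    then show ?thesis using bond_coin_quiet assms(1) by simp
  next
    case False
    then show ?thesis using z bond_coin_eq[of z k] assms by auto
  qed
qed

text \<open>
  A row in which a ring is used moves the paths in the block by the jump rule of the ASEP at this
  ring. By the order of the slots no other ring is used in this row, so \<open>row_config_Suc_single\<close>
  leaves a single bond \<open>v\<close> to be examined.
\<close>

lemma row_Suc_ring: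
  assumes k: "k < Y" and q: "snd q \<in> {a<..b}" "s \<in> N q" "slot q s = Suc k" and z: "z \<in> {a<..b}"
  shows "row (Suc k) z = Some w \<longleftrightarrow>
     (\<exists>v \<in> {a<..b}. row k v = Some w \<and> jump N s (\<lambda>v. row k v \<noteq> None) v = z)"
proof -
  have st: "s \<le> t" using slot_le_iff[of q s] q k by auto
  have uniq: "q' = q \<and> s' = s" if "snd q' \<in> {a..b+1}" "s' \<in> N q'" "slot q' s' = Suc k" for q' s'
  proof -
    have "s' \<le> t" using slot_le_iff[OF that(1,2)] that k by auto
    then have "s = s'" using slot_mono[of q q' s s'] slot_mono[of q' q s' s] that q st
      by (cases s s' rule: linorder_cases) auto
    then show ?thesis using ring_inj that q by auto
  qed
  have ring_eq: "s \<in> N q' \<longleftrightarrow> q' = q" for q' using q ring_inj[of s q q'] by auto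
  obtain v where v: "a < v" "v < b" and qv: "q = (Rightward, v) \<or> q = (Leftward, v + 1)"
  proof (cases "fst q")
    case Rightward
    then have q': "q = (Rightward, snd q)" by (metis prod.collapse)
    have "snd q \<noteq> b" using quiet[of b q s] q' q(2) st by (cases q) auto
    then show ?thesis using that[of "snd q"] q' q by auto
  next
    case Leftward
    then have q': "q = (Leftward, snd q - 1 + 1)" by (cases q) auto
    have "snd q \<noteq> a + 1" using quiet[of a q s] q' q(2) st by (cases q) auto
    then show ?thesis using that[of "snd q - 1"] q' q by auto
  qed
  have coin: "bond_coin c k z = (q = (Leftward, z + 1), q = (Rightward, z))" if "z \<in> {a..b}" for z
    using bond_coin_eq[OF that k] uniq[of "(Leftward, z + 1)"] uniq[of "(Rightward, z)"] that q by auto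
  have off: "bond_coin c k z = (False, False)" if "z \<in> {a..b}" "z \<noteq> v" for z
    using coin[OF that(1)] qv that by auto
  have same: "row (Suc k) z = row k z" if "z \<noteq> v" "z \<noteq> v + 1"
    by (rule row_config_Suc_single(1)[where a = a and b = b and v = v]) (use off v z that in auto)
  have upd: "(row (Suc k) v, row (Suc k) (v + 1)) =
      vertex_out (q = (Leftward, v + 1), q = (Rightward, v)) (row k (v + 1)) (row k v)"
    using row_config_Suc_single(2)[OF off v, where \<phi> = \<phi>] coin[of v] v by simp
  \<comment> \<open>The new position, by the rule of the ASEP, of a path at a given site of the block.\<close>
  define f where "f = jump N s (\<lambda>v. row k v \<noteq> None)"
  have f_other: "f u = u" if "u \<noteq> v" "u \<noteq> v + 1" for u
    using qv that by (auto simp: f_def jump_def ring_eq)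
  have f_v: "f v = (if q = (Rightward, v) \<and> row k (v + 1) = None then v + 1 else v)"
    using qv by (auto simp: f_def jump_def ring_eq)
  have f_v1: "f (v + 1) = (if q = (Leftward, v + 1) \<and> row k v = None then v else v + 1)"
    using qv by (auto simp: f_def jump_def ring_eq)
  have "row (Suc k) z = Some w \<longleftrightarrow> (\<exists>u \<in> {a<..b}. row k u = Some w \<and> f u = z)"
  proof (cases "z = v \<or> z = v + 1")
    case False
    have "f v \<in> {v, v + 1}" "f (v + 1) \<in> {v, v + 1}" using f_v f_v1 by auto
    with False have "f u = z \<longleftrightarrow> u = z" for u
      using f_other[of u] by (cases "u = v \<or> u = v + 1") auto
    then show ?thesis using same False z by auto
  next
    case True
    have "f u = z \<Longrightarrow> u = v \<or> u = v + 1" for u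
      using f_other[of u] True by metis
    then have "(\<exists>u \<in> {a<..b}. row k u = Some w \<and> f u = z) \<longleftrightarrow>
        (row k v = Some w \<and> f v = z) \<or> (row k (v + 1) = Some w \<and> f (v + 1) = z)"
      using v by auto
    also have "\<dots> \<longleftrightarrow> row (Suc k) z = Some w"
      using True upd qv
      by (cases "row k v"; cases "row k (v + 1)") (auto simp: f_v f_v1 split: if_splits)
    finally show ?thesis by simp
  qed
  then show ?thesis by (simp add: f_def)
qed

text \<open>
  The heart of the coupling. The row \<open>k\<close> is compared with the ASEP at any time \<open>\<theta>\<close> that separates the
  rings used up to row \<open>k\<close> from the later ones. If the next row uses no ring, \<open>\<theta>\<close> also separates for
  the row before. Otherwise it uses exactly one ring, at some time \<open>s\<close>: the last ring time before \<open>s\<close>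
  separates for the row before, and both models make the same jump at \<open>s\<close>. The statement is about
  pairs of a starting point and a position, so that exclusion in the ASEP comes for free, from the
  fact that \<open>row k z\<close> is a single path.
\<close>

lemma row_matches_asep:
  assumes "k \<le> Y" "0 \<le> \<theta>" "\<theta> \<le> t"
    and "\<And>q s. snd q \<in> {a<..b} \<Longrightarrow> s \<in> N q \<Longrightarrow> slot q s \<le> k \<longleftrightarrow> s \<le> \<theta>"
    and "z \<in> {a<..b}"
  shows "row k z = Some (path_from y) \<longleftrightarrow> (\<exists>i. X i 0 = Some y \<and> X i \<theta> = Some z)"
  using assms
proof (induction k arbitrary: \<theta> z y)
  case 0
  have none: "\<not> block_ring s" if "0 < s" "s \<le> \<theta>" for s
  proof
    assume "block_ring s"
    then obtain q where q: "snd q \<in> {a<..b}" "s \<in> N q" by (auto simp: block_ring_def)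
    then have "slot q s \<le> 0" using 0(4) that by blast
    then show False using slot_late[of q s] q that 0 a_le by auto
  qed
  have "(\<exists>i. X i 0 = Some y \<and> X i \<theta> = Some z) \<longleftrightarrow> (\<exists>i. X i 0 = Some y) \<and> y = z"
  proof (intro iffI conjI; (elim exE conjE)?)
    fix i assume i: "X i 0 = Some y" "X i \<theta> = Some z"
    obtain z' where "X i \<theta> = Some z'" "z' \<in> {a<..b} \<longleftrightarrow> y \<in> {a<..b}"
      by (rule block_confined[OF i(1) 0(2,3)])
    with i 0(5) have "y \<in> {a<..b}" by simp
    then show "y = z" using rests_between_rings[OF _ 0(2) i(1) _ none] i by simp
    show "\<exists>i. X i 0 = Some y" using i by blast
  next
    fix i assume "y = z" "X i 0 = Some y"
    then show "\<exists>i. X i 0 = Some y \<and> X i \<theta> = Some z"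
      using rests_between_rings[OF _ 0(2), of i z] none 0(5) by auto
  qed
  then show ?case
    using start_occupied occupied_start
    by (auto simp: row_config_0 initial_config_def)
next
  case (Suc k)
  show ?case
  proof (cases "\<exists>q s. snd q \<in> {a<..b} \<and> s \<in> N q \<and> slot q s = Suc k")
    case False
    then have "row (Suc k) z = row k z"
      using row_Suc_quiet[of k z] Suc.prems by auto
    moreover have "slot q s \<le> k \<longleftrightarrow> s \<le> \<theta>" if "snd q \<in> {a<..b}" "s \<in> N q" for q s
    proof -
      have "slot q s \<noteq> Suc k" using False that by blast
      then show ?thesis using Suc.prems(4)[OF that] by (auto simp: le_Suc_eq)
    qed
    ultimately show ?thesis using Suc.IH[of \<theta> z y] Suc.prems by auto
  next
    case True
    then obtain q s where q: "snd q \<in> {a<..b}" "s \<in> N q" "slot q s = Suc k" by blast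
    have s: "0 < s" "s \<le> \<theta>" "s \<le> t"
      using ring_pos q Suc.prems(3) Suc.prems(4)[OF q(1,2)] by auto
    have order: "slot q' s' \<le> k \<longleftrightarrow> s' < s" "s' \<le> \<theta> \<longleftrightarrow> s' \<le> s"
      if "snd q' \<in> {a<..b}" "s' \<in> N q'" for q' s'
    proof -
      have "s' < s \<Longrightarrow> slot q' s' < slot q s" "s < s' \<Longrightarrow> s' \<le> t \<Longrightarrow> slot q s < slot q' s'"
        using slot_mono[of q' q s' s] slot_mono[of q q' s s'] that q s by auto
      moreover have "s' = s \<Longrightarrow> q' = q" using ring_inj that q by blast
      moreover have "slot q' s' \<le> Suc k \<longleftrightarrow> s' \<le> \<theta>" using Suc.prems(4)[OF that] .
      ultimately show "slot q' s' \<le> k \<longleftrightarrow> s' < s" "s' \<le> \<theta> \<longleftrightarrow> s' \<le> s"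
        using q(3) Suc.prems(3) s by (cases s s' rule: linorder_cases; force)+
    qed
    \<comment> \<open>The last ring time before \<open>s\<close>, or \<open>0\<close>.\<close>
    define F where "F = insert 0 (\<Union>q' \<in> UNIV \<times> {a<..b}. N q' \<inter> {0<..s} - {s})"
    have "finite (UNIV \<times> {a<..b} :: (direction \<times> int) set)"
      by (simp add: UNIV_direction)
    then have finF: "finite F"
      unfolding F_def by (intro finite.insertI finite_UN_I finite_Diff ring_finite)
    define u where "u = Max F"
    have "u \<in> F" using finF unfolding u_def by (rule Max_in) (simp add: F_def)
    then have u: "0 \<le> u" "u < s" using s by (auto simp: F_def)
    have u_iff: "s' \<le> u \<longleftrightarrow> s' < s" if "snd q' \<in> {a<..b}" "s' \<in> N q'" for q' s'
    proof
      assume "s' < s"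
      then have "s' \<in> N q' \<inter> {0<..s} - {s}" using that(2) ring_pos by auto
      moreover have "q' \<in> UNIV \<times> {a<..b}" using that(1) by (simp add: mem_Times_iff)
      ultimately have "s' \<in> F" unfolding F_def by blast
      then show "s' \<le> u" using finF by (simp add: u_def)
    qed (use u in simp)
    have IH: "row k v = Some (path_from y) \<longleftrightarrow> (\<exists>i. X i 0 = Some y \<and> X i u = Some v)"
      if "v \<in> {a<..b}" for v y
      using that u s Suc.prems order u_iff by (intro Suc.IH) auto
    have none_before: "\<not> block_ring r" if "u < r" "r < s" for r
      using u_iff that by (force simp: block_ring_def)
    have none_after: "\<not> block_ring r" if "s < r" "r \<le> \<theta>" for r
      using order that by (force simp: block_ring_def)
    define f where "f = jump N s (\<lambda>v. row k v \<noteq> None)"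
    have occ: "row k v \<noteq> None \<longleftrightarrow> (\<exists>j. X j u = Some v)" if v: "v \<in> {a<..b}" for v
    proof
      assume "row k v \<noteq> None"
      then obtain w where w: "row k v = Some w" by auto
      then obtain y where "w = path_from y"
        using row_same_side[of k a v w] Suc.prems by (auto simp: same_side_def)
      then show "\<exists>j. X j u = Some v" using w IH[OF v] by auto
    next
      assume "\<exists>j. X j u = Some v"
      then obtain j where j: "X j u = Some v" by blast
      then obtain y where "X j 0 = Some y"
        using unused_stays[of j u] u by (cases "X j 0") auto
      then show "row k v \<noteq> None" using IH[OF v, of y] j by auto
    qed
    have jump_eq: "jump N s (\<lambda>w. \<exists>j. X j u = Some w) v = f v" if v: "v \<in> {a<..b}" for v
    proof -
      have "row k (v + 1) \<noteq> None \<longleftrightarrow> (\<exists>j. X j u = Some (v + 1))" if "s \<in> N (Rightward, v)"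
      proof -
        have "v \<noteq> b" using quiet[of b "(Rightward, b)" s] that s by auto
        with v show ?thesis by (intro occ) auto
      qed
      moreover have "row k (v - 1) \<noteq> None \<longleftrightarrow> (\<exists>j. X j u = Some (v - 1))" if "s \<in> N (Leftward, v)"
      proof -
        have "v \<noteq> a + 1" using quiet[of a "(Leftward, a + 1)" s] that s by auto
        with v show ?thesis by (intro occ) auto
      qed
      ultimately show ?thesis
        unfolding f_def jump_def
        by (cases "s \<in> N (Rightward, v)"; cases "s \<in> N (Leftward, v)")
          (simp_all del: not_None_eq not_Some_eq)
    qed
    have move: "X i \<theta> = Some (f v)" "f v \<in> {a<..b}"
      if i: "X i 0 = Some y" "X i u = Some v" and v: "v \<in> {a<..b}" for i y v
    proof -
      have at_s: "X i s = Some (f v)"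
        using jump_at_ring[OF u s(3) none_before i(2) v] jump_eq[OF v] by simp
      obtain w where w: "X i u = Some w" "w \<in> {a<..b} \<longleftrightarrow> y \<in> {a<..b}"
        by (rule block_confined[OF i(1), of u]) (use u s in auto)
      obtain w' where w': "X i s = Some w'" "w' \<in> {a<..b} \<longleftrightarrow> y \<in> {a<..b}"
        by (rule block_confined[OF i(1), of s]) (use u s in auto)
      show "f v \<in> {a<..b}" using w w' at_s i v by simp
      then show "X i \<theta> = Some (f v)"
        using rests_between_rings[OF _ s(2) at_s _ none_after] s by simp
    qed
    have "row (Suc k) z = Some (path_from y) \<longleftrightarrow>
        (\<exists>v \<in> {a<..b}. row k v = Some (path_from y) \<and> f v = z)"
      using row_Suc_ring[OF _ q] Suc.prems by (auto simp: f_def)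
    also have "\<dots> \<longleftrightarrow> (\<exists>v \<in> {a<..b}. (\<exists>i. X i 0 = Some y \<and> X i u = Some v) \<and> f v = z)"
      using IH by auto
    also have "\<dots> \<longleftrightarrow> (\<exists>i. X i 0 = Some y \<and> X i \<theta> = Some z)"
    proof
      assume "\<exists>v \<in> {a<..b}. (\<exists>i. X i 0 = Some y \<and> X i u = Some v) \<and> f v = z"
      then show "\<exists>i. X i 0 = Some y \<and> X i \<theta> = Some z" using move by blast
    next
      assume "\<exists>i. X i 0 = Some y \<and> X i \<theta> = Some z"
      then obtain i where i: "X i 0 = Some y" "X i \<theta> = Some z" by blast
      obtain v where v: "X i u = Some v" "v \<in> {a<..b} \<longleftrightarrow> y \<in> {a<..b}"
        by (rule block_confined[OF i(1), of u]) (use u s in auto)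
      obtain z' where "X i \<theta> = Some z'" "z' \<in> {a<..b} \<longleftrightarrow> y \<in> {a<..b}"
        by (rule block_confined[OF i(1), of \<theta>]) (use Suc.prems in auto)
      with v i Suc.prems(5) have "v \<in> {a<..b}" by simp
      with move[OF i(1) v(1)] i v show "\<exists>v \<in> {a<..b}. (\<exists>i. X i 0 = Some y \<and> X i u = Some v) \<and> f v = z"
        by auto
    qed
    finally show ?thesis .
  qed
qed

lemma final_row:
  assumes "z \<in> {a<..b}"
  shows "row Y z = Some (path_from y) \<longleftrightarrow> (\<exists>i. X i 0 = Some y \<and> X i t = Some z)"
  using row_matches_asep[of Y t z y] slot_le_iff t_nonneg assms by auto

lemma start_inj: "X i 0 = Some y \<Longrightarrow> X j 0 = Some y \<Longrightarrow> i = j"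
  using graph by (auto simp: graphical_asep_def)

text \<open>
  The intersections counted by the six-vertex current, in the moving frame. The condition on \<open>x\<close> keeps
  the columns to the right of \<open>X\<close> inside the quadrant.
\<close>

lemma row_Y_iff:
  assumes "0 \<le> x + int Y"
  shows "(\<exists>p. real p > real_of_int (x + int Y) \<and> fst (six_vertex_out \<phi> c p Y) = Some (From_y k))
     \<longleftrightarrow> (\<exists>z > x. row Y z = Some (From_y k))" (is "?A \<longleftrightarrow> ?B")
    and "(\<exists>p. real p \<le> real_of_int (x + int Y) \<and> fst (six_vertex_out \<phi> c p Y) = Some (From_x k))
     \<longleftrightarrow> (\<exists>z \<le> x. row Y z = Some (From_x k))" (is "?C \<longleftrightarrow> ?D")
proof -
  have row: "row Y (int p - int Y) = fst (six_vertex_out \<phi> c p Y)" if "p \<ge> 1" for p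
    using that by (simp add: row_config_def)
  have zero: "fst (six_vertex_out \<phi> c 0 Y) \<noteq> Some (From_x k)"
    by (cases Y) auto
  show "?A \<longleftrightarrow> ?B"
  proof
    assume ?A
    then obtain p where p: "real p > real_of_int (x + int Y)" "fst (six_vertex_out \<phi> c p Y) = Some (From_y k)" by blast
    then have "int p > x + int Y" by linarith
    then show ?B using row[of p] p(2) assms by (intro exI[of _ "int p - int Y"]) auto
  next
    assume ?B
    then obtain z where z: "z > x" "row Y z = Some (From_y k)" by blast
    then show ?A using row[of "nat (z + int Y)"] assms by (intro exI[of _ "nat (z + int Y)"]) auto
  qed
  show "?C \<longleftrightarrow> ?D"
  proof
    assume ?C
    then obtain p where p: "real p \<le> real_of_int (x + int Y)" "fst (six_vertex_out \<phi> c p Y) = Some (From_x k)" by blast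
    then have "int p \<le> x + int Y" by linarith
    moreover have "p \<ge> 1" using zero p by (cases p) auto
    ultimately show ?D using row[of p] p(2) by (intro exI[of _ "int p - int Y"]) auto
  next
    assume ?D
    then obtain z where z: "z \<le> x" "row Y z = Some (From_x k)" by blast
    have "z + int Y \<ge> 1"
    proof (rule ccontr)
      assume "\<not> z + int Y \<ge> 1"
      then show False using z(2)
        by (auto simp: row_config_def initial_config_def path_from_def split: if_splits)
    qed
    then show ?C using z row[of "nat (z + int Y)"] by (intro exI[of _ "nat (z + int Y)"]) auto
  qed
qed

text \<open>
  A blue path to the right of \<open>x\<close> starts to the left of \<open>b\<close> and ends to the right of \<open>a\<close>. Having
  crossed neither bond, it stays in the block, where the two models agree.
\<close>

lemma blue_iff:
  assumes "k \<ge> 1"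
  shows "(\<exists>z > x. row Y z = Some (From_y k)) \<longleftrightarrow>
     (\<exists>i z. X i 0 = Some (1 - int k) \<and> X i t = Some z \<and> z > x)"
proof -
  have pf: "path_from (1 - int k) = From_y k" using assms by (simp add: path_from_def)
  have "z \<in> {a<..b}" if "z > x" "row Y z = Some (From_y k)" for z
    using that row_same_side[of Y b z "From_y k"] a_le le_b pf assms
    by (auto simp: same_side_def path_from_def split: if_splits)
  moreover have "z \<in> {a<..b}" if "z > x" "X i 0 = Some (1 - int k)" "X i t = Some z" for i z
    using particle_same_side[OF that(2) t_nonneg order_refl, of b] that a_le le_b assms by auto
  ultimately show ?thesis using final_row[of _ "1 - int k"] pf by metis
qed

lemma red_iff:
  assumes "k \<ge> 1"
  shows "(\<exists>z \<le> x. row Y z = Some (From_x k)) \<longleftrightarrow>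
     (\<exists>i z. X i 0 = Some (int k) \<and> X i t = Some z \<and> z \<le> x)"
proof -
  have pf: "path_from (int k) = From_x k" using assms by (simp add: path_from_def)
  have "z \<in> {a<..b}" if "z \<le> x" "row Y z = Some (From_x k)" for z
    using that row_same_side[of Y a z "From_x k"] a_le le_b pf assms
    by (auto simp: same_side_def path_from_def split: if_splits)
  moreover have "z \<in> {a<..b}" if "z \<le> x" "X i 0 = Some (int k)" "X i t = Some z" for i z
    using particle_same_side[OF that(2) t_nonneg order_refl, of a] that a_le le_b assms by auto
  ultimately show ?thesis using final_row[of _ "int k"] pf by metis
qed

lemma row_From_pos:
  assumes "row Y z = Some w"
  shows "w \<noteq> From_x 0" "w \<noteq> From_y 0"
  using row_same_side[OF order_refl _ assms, of a] by (auto simp: same_side_def path_from_def split: if_splits)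

lemma currents_agree:
  assumes "0 \<le> x + int Y"
  shows "real_of_int (six_vertex_current (\<phi>, c) (real_of_int (x + int Y)) Y) = asep_current X t x"
proof -
  define A where "A = {k. \<exists>p. real p > real_of_int (x + int Y) \<and> fst (six_vertex_out \<phi> c p Y) = Some (From_y k)}"
  define B where "B = {k. \<exists>p. real p \<le> real_of_int (x + int Y) \<and> fst (six_vertex_out \<phi> c p Y) = Some (From_x k)}"
  define R where "R = right_crossers X t x"
  define L where "L = left_crossers X t x"
  have R: "i \<in> R \<longleftrightarrow> (\<exists>y z. X i 0 = Some y \<and> X i t = Some z \<and> y \<le> 0 \<and> x < z)" for i
    using particle_same_side[of i _ t a] t_nonneg by (fastforce simp: R_def right_crossers_def)
  have L: "i \<in> L \<longleftrightarrow> (\<exists>y z. X i 0 = Some y \<and> X i t = Some z \<and> 0 < y \<and> z \<le> x)" for i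
    using particle_same_side[of i _ t a] t_nonneg by (fastforce simp: L_def left_crossers_def)
  have start_inj_on: "inj_on (\<lambda>i. the (X i 0)) (R \<union> L)"
    unfolding inj_on_def by (auto simp: R L; metis start_inj)
  have "finite (R \<union> L)"
  proof (rule inj_on_finite[OF start_inj_on])
    have "y \<in> {a<..b}" if "X i 0 = Some y" "i \<in> R \<union> L" for i y
      using particle_same_side[OF that(1) t_nonneg order_refl, of a]
        particle_same_side[OF that(1) t_nonneg order_refl, of b] that a_le le_b
      by (auto simp: R L)
    then show "(\<lambda>i. the (X i 0)) ` (R \<union> L) \<subseteq> {a<..b}" by (auto simp: R L)
  qed simp
  moreover have "card A = card R"
  proof -
    have A0: "k \<in> A \<longleftrightarrow> k \<ge> 1 \<and> (\<exists>i z. X i 0 = Some (1 - int k) \<and> X i t = Some z \<and> z > x)" for k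
    proof (cases "k = 0")
      case False
      then show ?thesis using blue_iff[of k] unfolding A_def mem_Collect_eq row_Y_iff[OF assms]
        by (simp only: Suc_le_eq One_nat_def) auto
    next
      case True
      then show ?thesis using row_From_pos unfolding A_def mem_Collect_eq row_Y_iff[OF assms] by auto
    qed
    have "A = (\<lambda>i. nat (1 - the (X i 0))) ` R"
    proof (intro set_eqI iffI)
      fix k assume "k \<in> A"
      then obtain i z where "k \<ge> 1" "X i 0 = Some (1 - int k)" "X i t = Some z" "z > x" by (auto simp: A0)
      then show "k \<in> (\<lambda>i. nat (1 - the (X i 0))) ` R" by (intro image_eqI[of _ _ i]) (auto simp: R)
    next
      fix k assume "k \<in> (\<lambda>i. nat (1 - the (X i 0))) ` R"
      then show "k \<in> A" by (auto simp: A0 R; blast)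
    qed
    moreover have "inj_on (\<lambda>i. nat (1 - the (X i 0))) R"
    proof (rule inj_onI)
      fix i j assume ij: "i \<in> R" "j \<in> R" and eq: "nat (1 - the (X i 0)) = nat (1 - the (X j 0))"
      obtain y where y: "X i 0 = Some y" using ij(1) by (auto simp: R)
      moreover have "X j 0 = Some y" using ij eq y by (auto simp: R)
      ultimately show "i = j" by (rule start_inj)
    qed
    ultimately show ?thesis by (simp add: card_image)
  qed
  moreover have "card B = card L"
  proof -
    have B0: "k \<in> B \<longleftrightarrow> k \<ge> 1 \<and> (\<exists>i z. X i 0 = Some (int k) \<and> X i t = Some z \<and> z \<le> x)" for k
    proof (cases "k = 0")
      case False
      then show ?thesis using red_iff[of k] unfolding B_def mem_Collect_eq row_Y_iff[OF assms]
        by (simp only: Suc_le_eq One_nat_def) auto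
    next
      case True
      then show ?thesis using row_From_pos unfolding B_def mem_Collect_eq row_Y_iff[OF assms] by auto
    qed
    have "B = (\<lambda>i. nat (the (X i 0))) ` L"
    proof (intro set_eqI iffI)
      fix k assume "k \<in> B"
      then obtain i z where "k \<ge> 1" "X i 0 = Some (int k)" "X i t = Some z" "z \<le> x" by (auto simp: B0)
      then show "k \<in> (\<lambda>i. nat (the (X i 0))) ` L" by (intro image_eqI[of _ _ i]) (auto simp: L)
    next
      fix k assume "k \<in> (\<lambda>i. nat (the (X i 0))) ` L"
      then show "k \<in> B" by (auto simp: B0 L; blast)
    qed
    moreover have "inj_on (\<lambda>i. nat (the (X i 0))) L"
    proof (rule inj_onI)
      fix i j assume ij: "i \<in> L" "j \<in> L" and eq: "nat (the (X i 0)) = nat (the (X j 0))"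
      obtain y where y: "X i 0 = Some y" using ij(1) by (auto simp: L)
      moreover have "X j 0 = Some y" using ij eq y by (auto simp: L)
      ultimately show "i = j" by (rule start_inj)
    qed
    ultimately show ?thesis by (simp add: card_image)
  qed
  moreover have "six_vertex_current (\<phi>, c) (real_of_int (x + int Y)) Y = int (card A) - int (card B)"
    by (simp only: six_vertex_current_def A_def B_def fst_conv snd_conv)
  ultimately show ?thesis
    by (simp add: asep_current_eq R_def L_def)
qed

end

section \<open>Rings of the clocks in slots of time\<close>

text \<open>
  Almost sure statements about the clocks cannot assume that the exceptional set is measurable: the
  clocks are sets of points, of which only the counts are measurable. It is enough to cover the
  exceptional set by events of arbitrarily small probability.
\<close>

lemma (in prob_space) AE_not_if_small_cover:
  assumes "\<And>e. 0 < e \<Longrightarrow> \<exists>B \<in> events. prob B < e \<and> (AE \<omega> in M. P \<omega> \<longrightarrow> \<omega> \<in> B)"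
  shows "AE \<omega> in M. \<not> P \<omega>"
proof -
  have "\<exists>B. B \<in> events \<and> prob B < 1 / real (Suc n) \<and> (AE \<omega> in M. P \<omega> \<longrightarrow> \<omega> \<in> B)" for n
    using assms[of "1 / real (Suc n)"] by auto
  then obtain B where B: "\<And>n. B n \<in> events" "\<And>n. prob (B n) < 1 / real (Suc n)"
    "\<And>n. AE \<omega> in M. P \<omega> \<longrightarrow> \<omega> \<in> B n" by metis
  have "prob (\<Inter>n. B n) \<le> 1 / real (Suc n)" for n
    using finite_measure_mono[of "\<Inter>n. B n" "B n"] B(1)[of n] B(2)[of n]
    by (intro order.trans[OF finite_measure_mono[of "\<Inter>n. B n" "B n"]]) auto
  then have "prob (\<Inter>n. B n) \<le> 0"
    using LIMSEQ_le_const[OF LIMSEQ_Suc[OF lim_1_over_n]] by (metis (no_types, lifting))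
  then have "prob (\<Inter>n. B n) = 0" using measure_nonneg[of M "\<Inter>n. B n"] by linarith
  then have "AE \<omega> in M. \<omega> \<notin> (\<Inter>n. B n)"
    using B(1) by (intro AE_not_in) (auto simp: null_sets_def emeasure_eq_measure)
  moreover have "AE \<omega> in M. \<forall>n. P \<omega> \<longrightarrow> \<omega> \<in> B n"
    unfolding AE_all_countable using B(3) by blast
  ultimately show ?thesis by eventually_elim auto
qed

lemma (in prob_space) prob_tendsto_if_AE_eventually:
  assumes E: "\<And>n. E n \<in> events" "F \<in> events"
    and ev: "AE \<omega> in M. \<forall>\<^sub>F n in sequentially. \<omega> \<in> E n \<longleftrightarrow> \<omega> \<in> F"
  shows "(\<lambda>n. prob (E n)) \<longlonglongrightarrow> prob F"
proof -
  have "(\<lambda>n. \<integral>\<omega>. indicator (E n) \<omega> \<partial>M) \<longlonglongrightarrow> (\<integral>\<omega>. indicator F \<omega> \<partial>M :: real)"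
  proof (rule integral_dominated_convergence[where w = "\<lambda>_. 1"])
    show "AE \<omega> in M. (\<lambda>n. indicator (E n) \<omega>) \<longlonglongrightarrow> (indicator F \<omega> :: real)"
      using ev
    proof eventually_elim
      case (elim \<omega>)
      then have "\<forall>\<^sub>F n in sequentially. (indicator (E n) \<omega> :: real) = indicator F \<omega>"
        by eventually_elim (auto simp: indicator_def)
      then show ?case by (rule tendsto_eventually)
    qed
  qed (use E in \<open>auto simp: indicator_def\<close>)
  then show ?thesis using E by simp
qed

lemma AE_all_clocks:
  assumes "\<And>q. AE \<omega> in M. P (q :: direction \<times> int) \<omega>"
  shows "AE \<omega> in M. \<forall>q. P q \<omega>"
proof -
  have "AE \<omega> in M. \<forall>y. P (Leftward, y) \<omega>" "AE \<omega> in M. \<forall>y. P (Rightward, y) \<omega>"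
    using assms by (simp_all add: AE_all_countable)
  then show ?thesis
  proof eventually_elim
    case (elim \<omega>)
    then have "P (d, y) \<omega>" for d y by (cases d) auto
    then show ?case by auto
  qed
qed

context asep
begin

definition clock_rate :: "direction \<times> int \<Rightarrow> real" where
  "clock_rate q = (if fst q = Leftward then L else R)"

lemma clock_poisson: "poisson_process M (clock_rate q) (N q)"
  using left_clocks right_clocks by (cases q; cases "fst q") (auto simp: clock_rate_def)

lemma AE_clock_locally_finite:
  "AE \<omega> in M. \<forall>q. N q \<omega> \<subseteq> {0<..} \<and> (\<forall>b. finite (N q \<omega> \<inter> {0<..b}))"
  using clock_poisson by (intro AE_all_clocks) (simp add: poisson_process_def)

text \<open>
  The clock \<open>q\<close> rings in \<open>{u<..v}\<close>, expressed through its counting path, because the independence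
  of the clocks is the independence of these paths.
\<close>

definition rings :: "direction \<times> int \<Rightarrow> real \<Rightarrow> real \<Rightarrow> 'w \<Rightarrow> bool" where
  "rings q u v \<omega> \<longleftrightarrow> count_path (N q \<omega>) u \<noteq> count_path (N q \<omega>) v"

lemma count_path_differs_iff:
  assumes "finite (S \<inter> {0<..v})" "0 \<le> u" "u \<le> v"
  shows "count_path S u \<noteq> count_path S v \<longleftrightarrow> S \<inter> {u<..v} \<noteq> {}"
proof -
  have "S \<inter> {0<..v} = (S \<inter> {0<..u}) \<union> (S \<inter> {u<..v})" using assms by auto
  moreover have "finite (S \<inter> {0<..u})" "finite (S \<inter> {u<..v})"
    using assms by (auto intro: finite_subset[OF _ assms(1)])
  ultimately have "card (S \<inter> {0<..v}) = card (S \<inter> {0<..u}) + card (S \<inter> {u<..v})"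
    by (auto intro: card_Un_disjoint)
  then show ?thesis
    using assms \<open>finite (S \<inter> {u<..v})\<close> by (simp add: count_path_def)
qed

lemma AE_rings_iff:
  "AE \<omega> in M. \<forall>q u v. 0 \<le> u \<longrightarrow> u \<le> v \<longrightarrow> (rings q u v \<omega> \<longleftrightarrow> N q \<omega> \<inter> {u<..v} \<noteq> {})"
  using AE_clock_locally_finite
proof eventually_elim
  case (elim \<omega>)
  then have "finite (N q \<omega> \<inter> {0<..b})" for q b by blast
  then show ?case unfolding rings_def using count_path_differs_iff by blast
qed

lemma AE_rings_iff_card:
  assumes "0 \<le> u" "u \<le> v"
  shows "AE \<omega> in M. rings q u v \<omega> \<longleftrightarrow> card (N q \<omega> \<inter> {u<..v}) \<noteq> 0"
  using AE_clock_locally_finite AE_rings_iff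
proof eventually_elim
  case (elim \<omega>)
  have "finite (N q \<omega> \<inter> {u<..v})"
  proof (rule finite_subset)
    show "N q \<omega> \<inter> {u<..v} \<subseteq> N q \<omega> \<inter> {0<..v}" using assms by auto
    show "finite (N q \<omega> \<inter> {0<..v})" using elim(1) by blast
  qed
  moreover have "rings q u v \<omega> \<longleftrightarrow> N q \<omega> \<inter> {u<..v} \<noteq> {}"
    using elim(2) assms by blast
  ultimately show ?case by simp
qed

lemma count_path_measurable [measurable]:
  "(\<lambda>\<omega>. count_path (N q \<omega>)) \<in> measurable M count_path_space"
  using clocks_indep unfolding indep_vars_def by blast

lemma count_path_component_measurable:
  "0 \<le> u \<Longrightarrow> (\<lambda>f. f u) \<in> measurable count_path_space (count_space UNIV)"
  by (rule measurable_component_singleton) simp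

lemma path_differs_measurable:
  assumes "0 \<le> u" "0 \<le> v"
  shows "(\<lambda>f. f u \<noteq> f v) \<in> measurable count_path_space (count_space UNIV)"
  using count_path_component_measurable[OF assms(1)] count_path_component_measurable[OF assms(2)]
  by measurable

lemma rings_measurable:
  assumes "0 \<le> u" "0 \<le> v"
  shows "rings q u v \<in> measurable M (count_space UNIV)"
  using measurable_compose[OF count_path_measurable path_differs_measurable[OF assms]]
  by (simp add: rings_def[abs_def])

lemma prob_rings:
  assumes "0 \<le> u" "u \<le> v"
  shows "prob {\<omega> \<in> space M. rings q u v \<omega>} = 1 - exp (- clock_rate q * (v - u))"
proof -
  have m: "(\<lambda>\<omega>. card (N q \<omega> \<inter> {u<..v})) \<in> measurable M (count_space UNIV)"
    and p: "prob {\<omega> \<in> space M. card (N q \<omega> \<inter> {u<..v}) = 0} = exp (- clock_rate q * (v - u))"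
    using clock_poisson[of q] assms unfolding poisson_process_def by (auto dest: spec[of _ 0])
  have [measurable]: "rings q u v \<in> measurable M (count_space UNIV)"
    using rings_measurable assms by simp
  have ev: "{\<omega> \<in> space M. card (N q \<omega> \<inter> {u<..v}) = 0} \<in> events"
    using m by measurable
  have "prob {\<omega> \<in> space M. rings q u v \<omega>} = prob (space M - {\<omega> \<in> space M. card (N q \<omega> \<inter> {u<..v}) = 0})"
    using AE_rings_iff_card[OF assms, of q] ev by (intro finite_measure_eq_AE) auto
  then show ?thesis using p prob_compl[OF ev] by simp
qed

text \<open>
  The probability of a ring would be negative otherwise.
\<close>

lemma clock_rate_nonneg: "0 \<le> clock_rate q"
proof -
  have "0 \<le> 1 - exp (- clock_rate q * (1 - 0))"
    using prob_rings[of 0 1 q] measure_nonneg[of M "{\<omega> \<in> space M. rings q 0 1 \<omega>}"] by simp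
  then show ?thesis by simp
qed

lemma prob_rings_le:
  assumes "0 \<le> u" "u \<le> v"
  shows "prob {\<omega> \<in> space M. rings q u v \<omega>} \<le> clock_rate q * (v - u)"
  using prob_rings[OF assms, of q] exp_ge_add_one_self[of "- clock_rate q * (v - u)"] by simp

definition coin :: "(direction \<times> int \<Rightarrow> real) \<Rightarrow> (direction \<times> int) \<times> nat \<Rightarrow> 'w \<Rightarrow> bool" where
  "coin w = (\<lambda>(q, k). rings q (w q * real k) (w q * real (Suc k)))"

lemma coin_measurable: "(\<And>q. 0 \<le> w q) \<Longrightarrow> coin w j \<in> measurable M (count_space UNIV)"
  unfolding coin_def by (cases j) (auto intro!: rings_measurable)

text \<open>
  The increments of a Poisson process over consecutive slots are independent, and a coin is almost
  surely a function of such an increment.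
\<close>

lemma prob_coins_one_clock:
  assumes w: "0 \<le> w q" and K: "finite K"
  shows "prob {\<omega> \<in> space M. \<forall>k\<in>K. coin w (q, k) \<omega> \<in> B k}
     = (\<Prod>k\<in>K. prob {\<omega> \<in> space M. coin w (q, k) \<omega> \<in> B k})"
proof (cases "K = {}")
  case False
  define s where "s k = w q * real k" for k
  define c where "c k \<omega> = card (N q \<omega> \<inter> {s k<..s (Suc k)})" for k \<omega>
  have s: "0 \<le> s k" "s k \<le> s (Suc k)" for k using w by (auto simp: s_def mult_left_mono)
  have "mono s" using s by (simp add: mono_iff_le_Suc)
  then have ind: "indep_vars (\<lambda>_. count_space UNIV) c UNIV"
    using clock_poisson[of q] s(1)[of 0] unfolding poisson_process_def c_def by blast
  then have [measurable]: "c k \<in> measurable M (count_space UNIV)" for k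
    by (simp add: indep_vars_def)
  have coin: "coin w (q, k) = rings q (s k) (s (Suc k))" for k
    by (simp add: coin_def s_def)
  have [measurable]: "coin w (q, k) \<in> measurable M (count_space UNIV)" for k
    unfolding coin by (intro rings_measurable s)
  have ev: "{\<omega> \<in> space M. coin w (q, k) \<omega> \<in> B k} \<in> events" "{\<omega> \<in> space M. (c k \<omega> \<noteq> 0) \<in> B k} \<in> events" for k
    by measurable
  have AE: "AE \<omega> in M. \<forall>k. coin w (q, k) \<omega> \<longleftrightarrow> c k \<omega> \<noteq> 0"
    unfolding AE_all_countable using AE_rings_iff_card[OF s]
    by (auto simp: coin_def c_def s_def)
  have "prob {\<omega> \<in> space M. \<forall>k\<in>K. coin w (q, k) \<omega> \<in> B k} = prob {\<omega> \<in> space M. \<forall>k\<in>K. (c k \<omega> \<noteq> 0) \<in> B k}"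
    using AE K by (intro finite_measure_eq_AE) (auto intro!: sets.sets_Collect_finite_All ev)
  also have "\<dots> = prob (\<Inter>k\<in>K. c k -` {n. (n \<noteq> 0) \<in> B k} \<inter> space M)"
    using False by (intro arg_cong[where f = prob]) auto
  also have "\<dots> = (\<Prod>k\<in>K. prob (c k -` {n. (n \<noteq> 0) \<in> B k} \<inter> space M))"
    by (rule indep_varsD[OF ind False K]) auto
  also have "\<dots> = (\<Prod>k\<in>K. prob {\<omega> \<in> space M. (c k \<omega> \<noteq> 0) \<in> B k})"
    by (intro prod.cong arg_cong[where f = prob]) auto
  also have "\<dots> = (\<Prod>k\<in>K. prob {\<omega> \<in> space M. coin w (q, k) \<omega> \<in> B k})"
    using AE by (intro prod.cong finite_measure_eq_AE) (auto intro: ev)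
  finally show ?thesis .
qed (simp add: prob_space)

text \<open>
  Independence over all clocks and slots arises in two stages: group a finite family of coins by
  clocks, use independence of the clocks for the groups, and \<open>prob_coins_one_clock\<close> within each group.
\<close>

lemma indep_coins:
  assumes w: "\<And>q. 0 \<le> w q"
  shows "indep_vars (\<lambda>_. count_space UNIV) (coin w) UNIV"
  unfolding indep_vars_def2
proof (intro conjI ballI indep_setsI)
  show rv: "random_variable (count_space UNIV) (coin w j)" for j
    using coin_measurable w by blast
  show "{coin w j -` A \<inter> space M |A. A \<in> sets (count_space UNIV)} \<subseteq> events" for j
    using measurable_sets[OF rv] by blast
next
  fix A and J :: "((direction \<times> int) \<times> nat) set"
  assume J: "J \<noteq> {}" "finite J"
    and "\<forall>j\<in>J. A j \<in> {coin w j -` A \<inter> space M |A. A \<in> sets (count_space UNIV)}"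
  then have "\<forall>j\<in>J. \<exists>B. A j = coin w j -` B \<inter> space M" by blast
  then obtain B where B: "\<And>j. j \<in> J \<Longrightarrow> A j = coin w j -` B j \<inter> space M" by metis
  \<comment> \<open>Group the coins in \<open>J\<close> by their clocks; \<open>C q\<close> is the condition on the path of the clock \<open>q\<close>.\<close>
  define Q where "Q = fst ` J"
  define K where "K q = {k. (q, k) \<in> J}" for q
  have JQ: "J = Sigma Q K" by (force simp: Q_def K_def)
  have finQ: "finite Q" "Q \<noteq> {}" and finK: "finite (K q)" for q
  proof -
    show "finite Q" "Q \<noteq> {}" using J by (auto simp: Q_def)
    show "finite (K q)" unfolding K_def
      by (rule finite_subset[of _ "snd ` J"]) (use J in \<open>force+\<close>)
  qed
  define C where "C q = {f \<in> space count_path_space.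
      \<forall>k\<in>K q. (f (w q * real k) \<noteq> f (w q * real (Suc k))) \<in> B (q, k)}" for q
  have C: "C q \<in> sets count_path_space" for q
  proof -
    have "{f \<in> space count_path_space. (f (w q * real k) \<noteq> f (w q * real (Suc k))) \<in> B (q, k)}
        \<in> sets count_path_space" for k
      using measurable_sets[OF path_differs_measurable, of "w q * real k" "w q * real (Suc k)" "B (q, k)"] w[of q]
      by (simp add: vimage_def Int_def conj_commute)
    then show ?thesis unfolding C_def by (intro sets.sets_Collect_finite_All finK)
  qed
  have pre: "(\<lambda>\<omega>. count_path (N q \<omega>)) -` C q \<inter> space M =
      {\<omega> \<in> space M. \<forall>k\<in>K q. coin w (q, k) \<omega> \<in> B (q, k)}" for q
    using measurable_space[OF count_path_measurable, of _ q]
    by (auto simp: C_def coin_def rings_def)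
  have "prob (\<Inter>j\<in>J. A j) = prob (\<Inter>q\<in>Q. (\<lambda>\<omega>. count_path (N q \<omega>)) -` C q \<inter> space M)"
    unfolding pre using B finQ(2) J by (intro arg_cong[where f = prob]) (auto simp: JQ)
  also have "\<dots> = (\<Prod>q\<in>Q. prob ((\<lambda>\<omega>. count_path (N q \<omega>)) -` C q \<inter> space M))"
    by (rule indep_varsD[OF clocks_indep finQ(2,1)]) (auto intro: C)
  also have "\<dots> = (\<Prod>q\<in>Q. \<Prod>k\<in>K q. prob {\<omega> \<in> space M. coin w (q, k) \<omega> \<in> B (q, k)})"
    unfolding pre using w finK by (intro prod.cong prob_coins_one_clock) auto
  also have "\<dots> = (\<Prod>(q, k)\<in>J. prob {\<omega> \<in> space M. coin w (q, k) \<omega> \<in> B (q, k)})"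
    unfolding JQ using finQ finK by (intro prod.Sigma) auto
  also have "\<dots> = (\<Prod>j\<in>J. prob (A j))"
    using B by (intro prod.cong) (auto intro!: arg_cong[where f = prob])
  finally show "prob (\<Inter>j\<in>J. A j) = (\<Prod>j\<in>J. prob (A j))" .
qed

lemma prob_two_coins:
  assumes w: "\<And>q. 0 \<le> w q" and "i \<noteq> j"
  shows "prob {\<omega> \<in> space M. coin w i \<omega> = a \<and> coin w j \<omega> = b} =
     prob {\<omega> \<in> space M. coin w i \<omega> = a} * prob {\<omega> \<in> space M. coin w j \<omega> = b}"
proof -
  define B where "B k = (if k = i then {a} else {b})" for k
  have "prob (\<Inter>k\<in>{i, j}. coin w k -` B k \<inter> space M) = (\<Prod>k\<in>{i, j}. prob (coin w k -` B k \<inter> space M))"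
    by (rule indep_varsD[OF indep_coins[OF w]]) auto
  moreover have "(\<Inter>k\<in>{i, j}. coin w k -` B k \<inter> space M) = {\<omega> \<in> space M. coin w i \<omega> = a \<and> coin w j \<omega> = b}"
    using assms(2) by (auto simp: B_def)
  moreover have "coin w i -` B i \<inter> space M = {\<omega> \<in> space M. coin w i \<omega> = a}"
    "coin w j -` B j \<inter> space M = {\<omega> \<in> space M. coin w j \<omega> = b}"
    using assms(2) by (auto simp: B_def)
  ultimately show ?thesis using assms(2) by simp
qed

end

section \<open>The law of the coupled coins\<close>

abbreviation vertices :: "(nat \<times> nat) set" where
  "vertices \<equiv> {1..} \<times> {1..}"

context asep
begin

text \<open>
  Slots are counted from \<open>0\<close> here: the slot \<open>k\<close> provides the coins for the row \<open>k + 1\<close>.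
\<close>

definition bond_coins :: "(direction \<times> int \<Rightarrow> real) \<Rightarrow> int \<times> nat \<Rightarrow> 'w \<Rightarrow> bool \<times> bool" where
  "bond_coins w = (\<lambda>(z, k) \<omega>. (coin w ((Leftward, z + 1), k) \<omega>, coin w ((Rightward, z), k) \<omega>))"

lemma bond_coins_measurable:
  assumes w: "\<And>q. 0 \<le> w q"
  shows "bond_coins w v \<in> measurable M (count_space UNIV)"
proof -
  note [measurable] = coin_measurable[of w, OF w]
  have "bond_coins w v \<in> measurable M (count_space UNIV \<Otimes>\<^sub>M count_space UNIV)"
    unfolding bond_coins_def by (cases v) (simp, measurable)
  then show ?thesis by (simp add: pair_measure_countable)
qed

text \<open>
  Different bonds, or the same bond in different slots, use disjoint sets of coins.
\<close>

lemma indep_bond_coins: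
  assumes w: "\<And>q. 0 \<le> w q" and f: "inj_on f I"
  shows "indep_vars (\<lambda>_. count_space UNIV) (\<lambda>i. bond_coins w (f i)) I"
proof -
  define K where "K i = {((Leftward, fst (f i) + 1), snd (f i)), ((Rightward, fst (f i)), snd (f i))}" for i
  have "disjoint_family_on K I"
    using f by (auto simp: disjoint_family_on_def K_def inj_on_def prod_eq_iff)
  then have "indep_vars (\<lambda>i. PiM (K i) (\<lambda>_. count_space UNIV)) (\<lambda>i \<omega>. restrict (\<lambda>j. coin w j \<omega>) (K i)) I"
    by (intro indep_vars_restrict[OF indep_coins[OF w]]) auto
  then have "indep_vars (\<lambda>_. count_space UNIV)
     (\<lambda>i \<omega>. (\<lambda>g. (g ((Leftward, fst (f i) + 1), snd (f i)), g ((Rightward, fst (f i)), snd (f i))))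
        (restrict (\<lambda>j. coin w j \<omega>) (K i))) I"
  proof (rule indep_vars_compose2)
    fix i
    have "(\<lambda>g. (g ((Leftward, fst (f i) + 1), snd (f i)), g ((Rightward, fst (f i)), snd (f i))))
        \<in> measurable (PiM (K i) (\<lambda>_. count_space UNIV)) (count_space UNIV \<Otimes>\<^sub>M (count_space UNIV :: bool measure))"
      by (intro measurable_Pair measurable_component_singleton) (auto simp: K_def)
    then show "(\<lambda>g. (g ((Leftward, fst (f i) + 1), snd (f i)), g ((Rightward, fst (f i)), snd (f i))))
        \<in> measurable (PiM (K i) (\<lambda>_. count_space UNIV)) (count_space (UNIV :: (bool \<times> bool) set))"
      by (simp add: pair_measure_countable)
  qed
  then show ?thesis
    by (simp add: K_def bond_coins_def case_prod_unfold)
qed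

lemma prob_coin:
  assumes "0 \<le> w q"
  shows "prob {\<omega> \<in> space M. coin w (q, k) \<omega>} = 1 - exp (- clock_rate q * w q)"
  using prob_rings[of "w q * real k" "w q * real (Suc k)" q] assms
  by (simp add: coin_def algebra_simps)

lemma prob_coin_eq:
  assumes w: "\<And>q. 0 \<le> w q"
  shows "prob {\<omega> \<in> space M. coin w (q, k) \<omega> = b} = pmf (bernoulli_pmf (1 - exp (- clock_rate q * w q))) b"
proof -
  have [measurable]: "coin w (q, k) \<in> measurable M (count_space UNIV)" using coin_measurable w by blast
  have rate: "0 \<le> clock_rate q * w q"
    using clock_rate_nonneg w by simp
  show ?thesis
  proof (cases b)
    case True
    then show ?thesis using prob_coin[of w q k, OF w] rate by simp
  next
    case False
    have "prob {\<omega> \<in> space M. \<not> coin w (q, k) \<omega>} = 1 - prob {\<omega> \<in> space M. coin w (q, k) \<omega>}"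
      by (rule prob_neg) measurable
    then show ?thesis using prob_coin[of w q k, OF w] rate False by simp
  qed
qed

lemma distr_bond_coins:
  assumes w: "\<And>q. 0 \<le> w q"
    and dL: "\<And>y. 1 - exp (- clock_rate (Leftward, y) * w (Leftward, y)) = \<delta>1"
    and dR: "\<And>y. 1 - exp (- clock_rate (Rightward, y) * w (Rightward, y)) = \<delta>2"
  shows "distr M (count_space UNIV) (bond_coins w v)
    = measure_pmf (pair_pmf (bernoulli_pmf \<delta>1) (bernoulli_pmf \<delta>2))"
proof (rule measure_eqI_finite[where A = UNIV])
  fix ab :: "bool \<times> bool"
  obtain a b where ab: "ab = (a, b)" by (cases ab)
  obtain z k where v: "v = (z, k)" by (cases v)
  have "emeasure (distr M (count_space UNIV) (bond_coins w v)) {ab} =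
      emeasure M (bond_coins w v -` {ab} \<inter> space M)"
    using bond_coins_measurable[of w, OF w] by (intro emeasure_distr) auto
  also have "bond_coins w v -` {ab} \<inter> space M =
      {\<omega> \<in> space M. coin w ((Leftward, z + 1), k) \<omega> = a \<and> coin w ((Rightward, z), k) \<omega> = b}"
    by (auto simp: ab v bond_coins_def)
  also have "emeasure M \<dots> = ennreal (pmf (bernoulli_pmf \<delta>1) a * pmf (bernoulli_pmf \<delta>2) b)"
    unfolding emeasure_eq_measure
    by (subst prob_two_coins[of w, OF w]) (simp_all add: prob_coin_eq[of w, OF w] dL[simplified] dR[simplified])
  also have "\<dots> = emeasure (measure_pmf (pair_pmf (bernoulli_pmf \<delta>1) (bernoulli_pmf \<delta>2))) {ab}"
    by (simp add: emeasure_pmf_single ab pmf_pair)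
  finally show "emeasure (distr M (count_space UNIV) (bond_coins w v)) {ab} =
    emeasure (measure_pmf (pair_pmf (bernoulli_pmf \<delta>1) (bernoulli_pmf \<delta>2))) {ab}" .
qed auto

definition vertex_bond :: "nat \<times> nat \<Rightarrow> int \<times> nat" where
  "vertex_bond = (\<lambda>(p, k). (int p - int k, k - 1))"

definition vertex_coins :: "(direction \<times> int \<Rightarrow> real) \<Rightarrow> 'w \<Rightarrow> nat \<times> nat \<Rightarrow> bool \<times> bool" where
  "vertex_coins w \<omega> = (\<lambda>v\<in>vertices. bond_coins w (vertex_bond v) \<omega>)"

lemma distr_vertex_coins:
  assumes w: "\<And>q. 0 \<le> w q"
    and dL: "\<And>y. 1 - exp (- clock_rate (Leftward, y) * w (Leftward, y)) = \<delta>1"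
    and dR: "\<And>y. 1 - exp (- clock_rate (Rightward, y) * w (Rightward, y)) = \<delta>2"
  shows "distr M (PiM vertices (\<lambda>_. count_space UNIV)) (vertex_coins w)
    = PiM vertices (\<lambda>_. measure_pmf (pair_pmf (bernoulli_pmf \<delta>1) (bernoulli_pmf \<delta>2)))"
proof -
  have "inj_on vertex_bond vertices"
    by (auto simp: inj_on_def vertex_bond_def)
  then have "indep_vars (\<lambda>_. count_space UNIV) (\<lambda>v. bond_coins w (vertex_bond v)) vertices"
    by (rule indep_bond_coins[of w, OF w])
  moreover have "vertices \<noteq> {}" by auto
  ultimately have "distr M (PiM vertices (\<lambda>_. count_space UNIV)) (vertex_coins w)
      = PiM vertices (\<lambda>v. distr M (count_space UNIV) (bond_coins w (vertex_bond v)))"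
    using bond_coins_measurable[of w, OF w]
    by (subst (asm) indep_vars_iff_distr_eq_PiM) (auto simp: vertex_coins_def[abs_def])
  then show ?thesis
    by (simp add: distr_bond_coins[of w, OF w dL dR])
qed

text \<open>
  The coins are a measurable function of the counting paths of the clocks. This transfers the
  independence of the initial data from the clocks to the coins.
\<close>

lemma vertex_coins_of_paths:
  assumes w: "\<And>q. 0 \<le> w q"
  obtains h where "h \<in> measurable (PiM UNIV (\<lambda>_. count_path_space)) (PiM vertices (\<lambda>_. count_space UNIV))"
    and "\<And>\<omega>. vertex_coins w \<omega> = h (\<lambda>q. count_path (N q \<omega>))"
proof -
  define d where "d n j = (case j of (q, k) \<Rightarrow> n q (w q * real k) \<noteq> n q (w q * real (Suc k)))"
    for n :: "direction \<times> int \<Rightarrow> real \<Rightarrow> nat" and j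
  define h where "h n = (\<lambda>v\<in>vertices. case vertex_bond v of (z, k) \<Rightarrow>
     (d n ((Leftward, z + 1), k), d n ((Rightward, z), k)))" for n
  have d: "(\<lambda>n. d n j) \<in> measurable (PiM UNIV (\<lambda>_. count_path_space)) (count_space UNIV)" for j
  proof -
    obtain q k where j: "j = (q, k)" by (cases j)
    have "(\<lambda>n. n q) \<in> measurable (PiM UNIV (\<lambda>_. count_path_space)) count_path_space"
      by (rule measurable_component_singleton) simp
    from measurable_compose[OF this path_differs_measurable] show ?thesis
      using w[of q] by (simp add: d_def j)
  qed
  have "(\<lambda>n. (d n i, d n j)) \<in> measurable (PiM UNIV (\<lambda>_. count_path_space)) (count_space UNIV)" for i j
    using measurable_Pair[OF d d, of i j] by (simp add: pair_measure_countable)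
  then have "h \<in> measurable (PiM UNIV (\<lambda>_. count_path_space)) (PiM vertices (\<lambda>_. count_space UNIV))"
    unfolding h_def by (intro measurable_restrict) (simp add: case_prod_unfold)
  moreover have "vertex_coins w \<omega> = h (\<lambda>q. count_path (N q \<omega>))" for \<omega>
    by (auto simp: vertex_coins_def h_def d_def bond_coins_def coin_def rings_def case_prod_unfold)
  ultimately show ?thesis using that by blast
qed

lemma prob_initial_vertex_coins:
  assumes w: "\<And>q. 0 \<le> w q" and A: "A \<in> sets data_space"
    and B: "B \<in> sets (PiM vertices (\<lambda>_. count_space UNIV))"
  shows "prob (\<phi> -` A \<inter> space M \<inter> (vertex_coins w -` B \<inter> space M))
     = prob (\<phi> -` A \<inter> space M) * prob (vertex_coins w -` B \<inter> space M)"
proof -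
  obtain h where h: "h \<in> measurable (PiM UNIV (\<lambda>_. count_path_space)) (PiM vertices (\<lambda>_. count_space UNIV))"
    "\<And>\<omega>. vertex_coins w \<omega> = h (\<lambda>q. count_path (N q \<omega>))"
    using vertex_coins_of_paths[of w, OF w] by blast
  define paths where "paths \<omega> q = count_path (N q \<omega>)" for \<omega> q
  have paths: "paths \<in> measurable M (PiM UNIV (\<lambda>_. count_path_space))"
    unfolding paths_def
    by (rule measurable_PiM_single') (auto intro: measurable_space[OF count_path_measurable])
  have "vertex_coins w -` B \<inter> space M = paths -` (h -` B \<inter> space (PiM UNIV (\<lambda>_. count_path_space))) \<inter> space M"
    using measurable_space[OF paths] by (auto simp: h(2) paths_def[abs_def])
  moreover have "h -` B \<inter> space (PiM UNIV (\<lambda>_. count_path_space)) \<in> sets (PiM UNIV (\<lambda>_. count_path_space))"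
    using h(1) B by (rule measurable_sets)
  ultimately have "vertex_coins w -` B \<inter> space M \<in> sets (vimage_algebra (space M) paths (PiM UNIV (\<lambda>_. count_path_space)))"
    by (simp only: in_vimage_algebra)
  moreover have "\<phi> -` A \<inter> space M \<in> sets (vimage_algebra (space M) \<phi> data_space)"
    using A by (rule in_vimage_algebra)
  ultimately show ?thesis
    using initial_indep unfolding paths_def by (intro indep_setD)
qed

lemma vertex_coins_measurable:
  assumes w: "\<And>q. 0 \<le> w q"
  shows "vertex_coins w \<in> measurable M (PiM vertices (\<lambda>_. count_space UNIV))"
  unfolding vertex_coins_def[abs_def]
  by (intro measurable_restrict bond_coins_measurable w)

text \<open>
  The coupled data and coins have the law of the stochastic six-vertex model: the coins are independent
  with the right biases, and they are independent of the initial data.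
\<close>

lemma distr_coupling:
  assumes w: "\<And>q. 0 \<le> w q"
    and dL: "\<And>y. 1 - exp (- clock_rate (Leftward, y) * w (Leftward, y)) = \<delta>1"
    and dR: "\<And>y. 1 - exp (- clock_rate (Rightward, y) * w (Rightward, y)) = \<delta>2"
  shows "distr M (data_space \<Otimes>\<^sub>M PiM vertices (\<lambda>_. count_space UNIV)) (\<lambda>\<omega>. (\<phi> \<omega>, vertex_coins w \<omega>))
     = six_vertex \<delta>1 \<delta>2 \<Phi>"
proof -
  let ?V = "PiM vertices (\<lambda>_. count_space UNIV) :: (nat \<times> nat \<Rightarrow> bool \<times> bool) measure"
  let ?T = "\<lambda>\<omega>. (\<phi> \<omega>, vertex_coins w \<omega>)"
  note vm = vertex_coins_measurable[of w, OF w]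
  have T: "?T \<in> measurable M (data_space \<Otimes>\<^sub>M ?V)"
    using initial_measurable vm by measurable
  have "distr M data_space \<phi> \<Otimes>\<^sub>M distr M ?V (vertex_coins w) = distr M (data_space \<Otimes>\<^sub>M ?V) ?T"
  proof (rule pair_measure_eqI)
    show "sigma_finite_measure (distr M data_space \<phi>)" "sigma_finite_measure (distr M ?V (vertex_coins w))"
      using prob_space_distr[OF initial_measurable] prob_space_distr[OF vm]
      by (simp_all add: prob_space_imp_sigma_finite)
    fix A B assume "A \<in> sets (distr M data_space \<phi>)" "B \<in> sets (distr M ?V (vertex_coins w))"
    then have A: "A \<in> sets data_space" and B: "B \<in> sets ?V" by simp_all
    have "?T -` (A \<times> B) \<inter> space M = \<phi> -` A \<inter> space M \<inter> (vertex_coins w -` B \<inter> space M)" by auto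
    then show "emeasure (distr M data_space \<phi>) A * emeasure (distr M ?V (vertex_coins w)) B =
        emeasure (distr M (data_space \<Otimes>\<^sub>M ?V) ?T) (A \<times> B)"
      using prob_initial_vertex_coins[of w, OF w A B] A B
      by (simp only: emeasure_distr[OF initial_measurable A] emeasure_distr[OF vm B]
          emeasure_distr[OF T pair_measureI[OF A B]])
        (simp add: emeasure_eq_measure ennreal_mult)
  qed simp
  then show ?thesis
    using distr_vertex_coins[of w, OF w dL dR] initial_law by (simp add: six_vertex_def)
qed

section \<open>Almost sure properties of the clocks\<close>

text \<open>
  Split \<open>{0<..T}\<close> into \<open>n\<close> slots. Two given clocks both ring in a given slot with probability
  \<open>O(1 / n\<^sup>2)\<close>, hence in a common slot with probability \<open>O(1 / n)\<close>.
\<close>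

lemma AE_no_simultaneous_rings:
  "AE \<omega> in M. \<forall>q q' s. s \<in> N q \<omega> \<longrightarrow> s \<in> N q' \<omega> \<longrightarrow> q = q'"
proof -
  have "AE \<omega> in M. \<not> (\<exists>s. 0 < s \<and> s \<le> real T \<and> s \<in> N q \<omega> \<and> s \<in> N q' \<omega>)" if "q \<noteq> q'" for q q' T
  proof (rule AE_not_if_small_cover)
    fix e :: real assume "e > 0"
    define C where "C = clock_rate q * clock_rate q' * (real T)\<^sup>2"
    obtain n where n: "C / e < real n" "n > 0"
      using reals_Archimedean2[of "max 1 (C / e)"] by fastforce
    define w where "w = (\<lambda>_ :: direction \<times> int. real T / real n)"
    have w: "0 \<le> w q" for q by (simp add: w_def)
    note [measurable] = coin_measurable[of w, OF w]
    define B where "B k = {\<omega> \<in> space M. coin w (q, k) \<omega> \<and> coin w (q', k) \<omega>}" for k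
    have B: "B k \<in> events" for k unfolding B_def by measurable
    have coin_le: "prob {\<omega> \<in> space M. coin w (q, k) \<omega>} \<le> clock_rate q * w q" for q k
      using prob_coin[of w q k, OF w] exp_ge_add_one_self[of "- clock_rate q * w q"] by simp
    have rate: "0 \<le> clock_rate q * w q" for q
      using clock_rate_nonneg w by simp
    have "prob (B k) \<le> C / (real n)\<^sup>2" for k
    proof -
      have "prob (B k) = prob {\<omega> \<in> space M. coin w (q, k) \<omega>} * prob {\<omega> \<in> space M. coin w (q', k) \<omega>}"
        using prob_two_coins[of w "(q, k)" "(q', k)" True True] w that by (simp add: B_def)
      also have "\<dots> \<le> (clock_rate q * w q) * (clock_rate q' * w q')"
        by (intro mult_mono coin_le rate) simp
      also have "\<dots> = C / (real n)\<^sup>2" by (simp add: w_def C_def power2_eq_square)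
      finally show ?thesis .
    qed
    then have "prob (\<Union>k<n. B k) \<le> real n * (C / (real n)\<^sup>2)"
      using finite_measure_subadditive_finite[of "{..<n}" B] B
        sum_bounded_above[of "{..<n}" "\<lambda>k. prob (B k)" "C / (real n)\<^sup>2"] by fastforce
    also have "\<dots> = C / real n" using n by (simp add: power2_eq_square)
    also have "\<dots> < e" using n \<open>e > 0\<close> by (simp add: field_simps)
    finally have "prob (\<Union>k<n. B k) < e" .
    moreover have "AE \<omega> in M. (\<exists>s. 0 < s \<and> s \<le> real T \<and> s \<in> N q \<omega> \<and> s \<in> N q' \<omega>) \<longrightarrow> \<omega> \<in> (\<Union>k<n. B k)"
      using AE_rings_iff AE_space
    proof eventually_elim
      case (elim \<omega>)
      show ?case
      proof
        assume "\<exists>s. 0 < s \<and> s \<le> real T \<and> s \<in> N q \<omega> \<and> s \<in> N q' \<omega>"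
        then obtain s where s: "0 < s" "s \<le> real T" "s \<in> N q \<omega>" "s \<in> N q' \<omega>" by blast
        define h where "h = real T / real n"
        have h: "h > 0" using s n by (simp add: h_def)
        \<comment> \<open>Slots are open on the left and closed on the right, hence the rounding up.\<close>
        define k where "k = nat (\<lceil>s / h\<rceil> - 1)"
        have "0 < s / h" "s / h \<le> real n" using s h n by (simp_all add: h_def field_simps)
        then have k: "real k < s / h" "s / h \<le> real (Suc k)" "k < n"
          unfolding k_def by linarith+
        then have "s \<in> {h * real k<..h * real (Suc k)}" using h by (simp add: field_simps)
        then have "N q0 \<omega> \<inter> {h * real k<..h * real (Suc k)} \<noteq> {}" if "q0 \<in> {q, q'}" for q0
          using s that by auto
        moreover have "0 \<le> h * real k" "h * real k \<le> h * real (Suc k)" using h by auto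
        ultimately have "rings q0 (h * real k) (h * real (Suc k)) \<omega>" if "q0 \<in> {q, q'}" for q0
          using elim(1) that by blast
        then have "\<omega> \<in> B k"
          using elim(2) by (simp add: B_def coin_def w_def h_def)
        then show "\<omega> \<in> (\<Union>k<n. B k)" using k(3) by blast
      qed
    qed
    ultimately show "\<exists>B\<in>events. prob B < e \<and>
        (AE \<omega> in M. (\<exists>s. 0 < s \<and> s \<le> real T \<and> s \<in> N q \<omega> \<and> s \<in> N q' \<omega>) \<longrightarrow> \<omega> \<in> B)"
      using B by (intro bexI[of _ "\<Union>k<n. B k"]) auto
  qed
  then have "AE \<omega> in M. \<forall>q q'. \<forall>T :: nat. q \<noteq> q' \<longrightarrow> \<not> (\<exists>s. 0 < s \<and> s \<le> real T \<and> s \<in> N q \<omega> \<and> s \<in> N q' \<omega>)"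
    by (intro AE_all_clocks) (simp add: AE_all_countable)
  then show ?thesis
    using AE_clock_locally_finite
  proof eventually_elim
    case (elim \<omega>)
    show ?case
    proof (intro allI impI)
      fix q q' s assume s: "s \<in> N q \<omega>" "s \<in> N q' \<omega>"
      then have "0 < s" using elim(2) by (auto simp del: split_paired_All)
      moreover obtain T where "s \<le> real T" using real_arch_simple by blast
      ultimately show "q = q'" using elim(1) s by blast
    qed
  qed
qed

lemma AE_no_ring_at:
  assumes "0 < t"
  shows "AE \<omega> in M. \<forall>q. t \<notin> N q \<omega>"
proof (rule AE_all_clocks, rule AE_not_if_small_cover)
  fix q and e :: real assume "e > 0"
  \<comment> \<open>A window before \<open>t\<close> so short that the clock rings in it with probability at most \<open>e / 2\<close>.\<close>
  define h where "h = min t (e / (2 * (\<bar>clock_rate q\<bar> + 1)))"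
  have h: "0 < h" "h \<le> t" using assms \<open>e > 0\<close> by (auto simp: h_def)
  have "clock_rate q * h \<le> (\<bar>clock_rate q\<bar> + 1) * (e / (2 * (\<bar>clock_rate q\<bar> + 1)))"
    using h by (intro mult_mono) (auto simp: h_def)
  also have "\<dots> = e / 2"
    by (simp add: divide_simps)
  finally have le: "clock_rate q * h \<le> e / 2" .
  have [measurable]: "rings q (t - h) t \<in> measurable M (count_space UNIV)"
    using h by (intro rings_measurable) auto
  define B where "B = {\<omega> \<in> space M. rings q (t - h) t \<omega>}"
  have "B \<in> events" unfolding B_def by measurable
  moreover have "prob B < e"
    using prob_rings_le[of "t - h" t q] h le \<open>e > 0\<close> by (simp add: B_def)
  moreover have "AE \<omega> in M. t \<in> N q \<omega> \<longrightarrow> \<omega> \<in> B"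
    using AE_rings_iff AE_space
  proof eventually_elim
    case (elim \<omega>)
    have "0 \<le> t - h" "t - h \<le> t" using h by auto
    then have "rings q (t - h) t \<omega> \<longleftrightarrow> N q \<omega> \<inter> {t - h<..t} \<noteq> {}" using elim(1) by blast
    then show ?case using elim(2) h by (auto simp: B_def)
  qed
  ultimately show "\<exists>B\<in>events. prob B < e \<and> (AE \<omega> in M. t \<in> N q \<omega> \<longrightarrow> \<omega> \<in> B)" by blast
qed

definition quiet_bond :: "real \<Rightarrow> 'w \<Rightarrow> int \<Rightarrow> bool" where
  "quiet_bond T \<omega> z \<longleftrightarrow> N (Rightward, z) \<omega> \<inter> {0<..T} = {} \<and> N (Leftward, z + 1) \<omega> \<inter> {0<..T} = {}"

text \<open>
  Each bond is quiet with the same positive probability, independently of the others, so almost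
  surely infinitely many bonds do not all fail to be quiet.
\<close>

lemma AE_quiet_bond_in_range:
  assumes "0 \<le> T" and g: "inj g"
  shows "AE \<omega> in M. \<not> (\<forall>n :: nat. \<not> quiet_bond T \<omega> (g n))"
proof (rule AE_not_if_small_cover)
  fix e :: real assume "e > 0"
  define w where "w = (\<lambda>_ :: direction \<times> int. T)"
  have w: "0 \<le> w q" for q using assms by (simp add: w_def)
  define B where "B n = {\<omega> \<in> space M. bond_coins w (g n, 0) \<omega> \<noteq> (False, False)}" for n
  note [measurable] = bond_coins_measurable[of w, OF w]
  have B: "B n \<in> events" for n unfolding B_def by measurable
  define c where "c = 1 - exp (- L * T) * exp (- R * T)"
  have c: "0 \<le> c" "c < 1"
  proof -
    show "c < 1" by (simp add: c_def)
    have "exp (- L * T) \<le> 1" "exp (- R * T) \<le> 1"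
      using clock_rate_nonneg[of "(Leftward, 0)"] clock_rate_nonneg[of "(Rightward, 0)"] assms
      by (simp_all add: clock_rate_def)
    then show "0 \<le> c" using mult_le_one[of "exp (- L * T)" "exp (- R * T)"] by (simp add: c_def)
  qed
  have pB: "prob (B n) = c" for n
  proof -
    have "prob {\<omega> \<in> space M. bond_coins w (g n, 0) \<omega> = (False, False)} = exp (- L * T) * exp (- R * T)"
    proof -
      have "prob {\<omega> \<in> space M. coin w ((Leftward, g n + 1), 0) \<omega> = False \<and> coin w ((Rightward, g n), 0) \<omega> = False}
        = pmf (bernoulli_pmf (1 - exp (- L * T))) False * pmf (bernoulli_pmf (1 - exp (- R * T))) False"
        using prob_two_coins[of w "((Leftward, g n + 1), 0)" "((Rightward, g n), 0)" False False, OF w]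
          prob_coin_eq[of w "(Leftward, g n + 1)" 0 False, OF w] prob_coin_eq[of w "(Rightward, g n)" 0 False, OF w]
        by (simp add: clock_rate_def w_def)
      also have "\<dots> = exp (- L * T) * exp (- R * T)"
      proof -
        have "pmf (bernoulli_pmf (1 - exp (- \<rho> * T))) False = exp (- \<rho> * T)" if "\<rho> \<in> {L, R}" for \<rho>
        proof -
          have "0 \<le> \<rho>"
            using that clock_rate_nonneg[of "(Leftward, 0)"] clock_rate_nonneg[of "(Rightward, 0)"]
            by (auto simp: clock_rate_def)
          then have "0 \<le> 1 - exp (- \<rho> * T)" using assms by simp
          then show ?thesis by simp
        qed
        then show ?thesis by simp
      qed
      finally show ?thesis by (simp add: bond_coins_def)
    qed
    moreover have "B n = space M - {\<omega> \<in> space M. bond_coins w (g n, 0) \<omega> = (False, False)}"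
      by (auto simp: B_def)
    moreover have "{\<omega> \<in> space M. bond_coins w (g n, 0) \<omega> = (False, False)} \<in> events" by measurable
    ultimately show ?thesis by (simp add: prob_compl c_def)
  qed
  have "(\<lambda>n. c ^ n) \<longlonglongrightarrow> 0" using c by (intro LIMSEQ_power_zero) auto
  then have "\<forall>\<^sub>F n in sequentially. c ^ n < e" using \<open>e > 0\<close> by (rule order_tendstoD)
  then obtain n0 where n0: "\<And>n. n \<ge> n0 \<Longrightarrow> c ^ n < e" by (auto simp: eventually_sequentially)
  define n where "n = Suc n0"
  have n: "c ^ n < e" "n > 0" using n0[of n] by (auto simp: n_def)
  have ind: "indep_vars (\<lambda>_. count_space UNIV) (\<lambda>n. bond_coins w (g n, 0)) {..<n}"
    by (rule indep_bond_coins[of w "\<lambda>n. (g n, 0)", OF w]) (use g in \<open>auto simp: inj_on_def\<close>)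
  have "prob (\<Inter>i\<in>{..<n}. bond_coins w (g i, 0) -` (- {(False, False)}) \<inter> space M)
      = (\<Prod>i\<in>{..<n}. prob (bond_coins w (g i, 0) -` (- {(False, False)}) \<inter> space M))"
    using n by (intro indep_varsD[OF ind]) auto
  moreover have "bond_coins w (g i, 0) -` (- {(False, False)}) \<inter> space M = B i" for i
    by (auto simp: B_def)
  ultimately have "prob (\<Inter>i\<in>{..<n}. B i) = c ^ n" by (simp add: pB)
  moreover have "(\<Inter>i\<in>{..<n}. B i) \<in> events" using B n by (intro sets.finite_INT) auto
  moreover have "AE \<omega> in M. (\<forall>n. \<not> quiet_bond T \<omega> (g n)) \<longrightarrow> \<omega> \<in> (\<Inter>i\<in>{..<n}. B i)"
    using AE_rings_iff AE_space
  proof eventually_elim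
    case (elim \<omega>)
    then have "rings q 0 T \<omega> \<longleftrightarrow> N q \<omega> \<inter> {0<..T} \<noteq> {}" for q using assms by blast
    then show ?case using elim(2)
      by (auto simp: B_def bond_coins_def coin_def w_def quiet_bond_def)
  qed
  ultimately show "\<exists>B\<in>events. prob B < e \<and> (AE \<omega> in M. (\<forall>n. \<not> quiet_bond T \<omega> (g n)) \<longrightarrow> \<omega> \<in> B)"
    using n(1) by (intro bexI[of _ "\<Inter>i\<in>{..<n}. B i"]) auto
qed

lemma AE_quiet_bonds:
  assumes "0 \<le> T"
  shows "AE \<omega> in M. (\<exists>a<m. quiet_bond T \<omega> a) \<and> (\<exists>b>m. quiet_bond T \<omega> b)"
proof -
  have "inj (\<lambda>n. m - 1 - int n)" "inj (\<lambda>n. m + 1 + int n)" by (auto simp: inj_on_def)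
  from AE_quiet_bond_in_range[OF assms this(1)] AE_quiet_bond_in_range[OF assms this(2)]
  show ?thesis
  proof eventually_elim
    case (elim \<omega>)
    then obtain n n' :: nat where "quiet_bond T \<omega> (m - 1 - int n)" "quiet_bond T \<omega> (m + 1 + int n')" by blast
    moreover have "m - 1 - int n < m" "m + 1 + int n' > m" by auto
    ultimately show ?case by blast
  qed
qed

end

section \<open>Measurability of the six-vertex current\<close>

instance path :: countable
  by countable_datatype

lemma measurable_discrete_pair:
  fixes f :: "'a \<Rightarrow> 'b::countable" and g :: "'a \<Rightarrow> 'c::countable"
  assumes "f \<in> measurable M (count_space UNIV)" "g \<in> measurable M (count_space UNIV)"
  shows "(\<lambda>x. h (f x) (g x)) \<in> measurable M (count_space UNIV)"
proof -
  have "(\<lambda>x. h b (g x)) \<in> measurable M (count_space UNIV)" for b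
    using measurable_compose[OF assms(2), of "h b"] by simp
  from measurable_compose_countable[OF this assms(1)] show ?thesis .
qed

abbreviation six_vertex_space :: "((nat \<Rightarrow> bool \<times> bool) \<times> (nat \<times> nat \<Rightarrow> bool \<times> bool)) measure" where
  "six_vertex_space \<equiv> data_space \<Otimes>\<^sub>M PiM vertices (\<lambda>_. count_space UNIV)"

lemma six_vertex_out_measurable:
  "(\<lambda>\<omega>. six_vertex_out (fst \<omega>) (snd \<omega>) p k) \<in> measurable six_vertex_space (count_space UNIV)"
proof -
  have data: "(\<lambda>\<omega>. h (fst \<omega> (Suc p))) \<in> measurable six_vertex_space (count_space UNIV)"
    for p and h :: "bool \<times> bool \<Rightarrow> path option \<times> path option"
  proof -
    have "(\<lambda>\<phi>. \<phi> (Suc p)) \<in> measurable data_space (count_space UNIV)"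
      unfolding data_space_def by (rule measurable_component_singleton) simp
    then have "(\<lambda>\<omega>. fst \<omega> (Suc p)) \<in> measurable six_vertex_space (count_space UNIV)"
      by (rule measurable_compose[OF measurable_fst])
    then show ?thesis by (rule measurable_compose) simp
  qed
  show ?thesis
  proof (induction k arbitrary: p)
    case 0
    show ?case
    proof (cases p)
      case (Suc n)
      then show ?thesis using data[where h = "\<lambda>d. (if fst d then Some (From_x (Suc n)) else None, None)"]
        by simp
    qed simp
  next
    case (Suc k)
    note below = Suc.IH
    show ?case
    proof (induction p)
      case 0
      then show ?case using data[where h = "\<lambda>d. (None, if snd d then Some (From_y (Suc k)) else None)"]
        by simp
    next
      case (Suc n)
      have "(\<lambda>c. c (Suc n, Suc k)) \<in> measurable (PiM vertices (\<lambda>_. count_space UNIV)) (count_space UNIV)"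
        by (rule measurable_component_singleton) simp
      then have "(\<lambda>\<omega>. snd \<omega> (Suc n, Suc k)) \<in> measurable six_vertex_space (count_space UNIV)"
        by (rule measurable_compose[OF measurable_snd])
      moreover have "(\<lambda>\<omega>. (six_vertex_out (fst \<omega>) (snd \<omega>) n (Suc k), six_vertex_out (fst \<omega>) (snd \<omega>) (Suc n) k))
          \<in> measurable six_vertex_space (count_space UNIV)"
        by (rule measurable_discrete_pair[where h = Pair]) (rule Suc.IH, rule below)
      ultimately have "(\<lambda>\<omega>. (\<lambda>d uv. vertex_out d (fst (snd uv)) (snd (fst uv))) (snd \<omega> (Suc n, Suc k))
          (six_vertex_out (fst \<omega>) (snd \<omega>) n (Suc k), six_vertex_out (fst \<omega>) (snd \<omega>) (Suc n) k))
          \<in> measurable six_vertex_space (count_space UNIV)"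
        by (rule measurable_discrete_pair)
      then show ?case by (simp only: six_vertex_out.simps fst_conv snd_conv)
    qed
  qed
qed

lemma six_vertex_current_measurable:
  "(\<lambda>\<omega>. six_vertex_current \<omega> x k) \<in> measurable six_vertex_space (count_space UNIV)"
proof -
  have out: "Measurable.pred six_vertex_space (\<lambda>\<omega>. fst (six_vertex_out (fst \<omega>) (snd \<omega>) p k) = w)" for p w
    using measurable_compose[OF six_vertex_out_measurable, of "\<lambda>uv. fst uv = w"] by simp
  have "Measurable.pred six_vertex_space (\<lambda>\<omega>. \<exists>p. P p \<and> fst (six_vertex_out (fst \<omega>) (snd \<omega>) p k) = w)" for P w
    using out by measurable
  then have "(\<lambda>\<omega>. card {j. \<exists>p. P p \<and> fst (six_vertex_out (fst \<omega>) (snd \<omega>) p k) = Some (f j)})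
      \<in> measurable six_vertex_space (count_space UNIV)" for P and f :: "nat \<Rightarrow> path"
    by (intro measurable_card) (simp add: pred_def)
  then show ?thesis
    unfolding six_vertex_current_def
    by (intro measurable_discrete_pair[where h = "\<lambda>m n. int m - int n"])
qed

section \<open>Slots of small width\<close>

text \<open>
  Solves \<open>1 - exp (- \<rho> w) = \<rho> \<epsilon>\<close> for \<open>w\<close>, so that a clock of rate \<open>\<rho>\<close> rings in a slot with probability
  exactly \<open>\<rho> \<epsilon>\<close>. A clock of rate \<open>0\<close> never rings; its slots get the limiting width.
\<close>

definition slot_width :: "real \<Rightarrow> real \<Rightarrow> real" where
  "slot_width \<rho> \<epsilon> = (if \<rho> = 0 then \<epsilon> else - ln (1 - \<rho> * \<epsilon>) / \<rho>)"

lemma exp_slot_width: "\<rho> * \<epsilon> < 1 \<Longrightarrow> 1 - exp (- \<rho> * slot_width \<rho> \<epsilon>) = \<epsilon> * \<rho>"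
  by (simp add: slot_width_def)

lemma slot_width_pos:
  assumes "0 \<le> \<rho>" "0 < \<epsilon>" "\<rho> * \<epsilon> < 1"
  shows "0 < slot_width \<rho> \<epsilon>"
proof (cases "\<rho> = 0")
  case False
  then have "0 < \<rho> * \<epsilon>" using assms by simp
  then have "ln (1 - \<rho> * \<epsilon>) < 0" using assms by (intro ln_less_zero) auto
  with False assms show ?thesis by (simp add: slot_width_def divide_neg_pos)
qed (use assms in \<open>simp add: slot_width_def\<close>)

lemma slot_width_asymp:
  assumes "0 \<le> \<rho>"
  shows "((\<lambda>\<epsilon>. slot_width \<rho> \<epsilon> / \<epsilon>) \<longlongrightarrow> 1) (at_right 0)"
proof (cases "\<rho> = 0")
  case True
  have "\<forall>\<^sub>F \<epsilon> in at_right 0. slot_width \<rho> \<epsilon> / \<epsilon> = (1 :: real)"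
    using eventually_at_right_less[of 0] by eventually_elim (simp add: slot_width_def True)
  then show ?thesis by (rule tendsto_eventually)
next
  case False
  then have "\<rho> > 0" using assms by simp
  then have "((\<lambda>\<epsilon>. (- ln (1 - \<rho> * \<epsilon>) / \<rho>) / \<epsilon>) \<longlongrightarrow> 1) (at_right 0)"
    by real_asymp
  with False show ?thesis by (simp add: slot_width_def)
qed

lemma eventually_small: "\<forall>\<^sub>F \<epsilon> in at_right 0. 0 < \<epsilon> \<and> \<rho> * \<epsilon> < (1::real)"
proof -
  have "((\<lambda>\<epsilon>. \<rho> * \<epsilon>) \<longlongrightarrow> \<rho> * 0) (at_right 0)" by (intro tendsto_intros)
  then have "\<forall>\<^sub>F \<epsilon> in at_right 0. \<rho> * \<epsilon> < 1" by (rule order_tendstoD) simp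
  with eventually_at_right_less[of 0] show ?thesis by eventually_elim simp
qed

definition slot_of :: "real \<Rightarrow> real \<Rightarrow> real \<Rightarrow> nat" where
  "slot_of \<rho> \<epsilon> s = nat \<lceil>s / slot_width \<rho> \<epsilon>\<rceil>"

lemma slot_of_eq_Suc_iff:
  assumes "0 < slot_width \<rho> \<epsilon>"
  shows "slot_of \<rho> \<epsilon> s = Suc k \<longleftrightarrow> s \<in> {slot_width \<rho> \<epsilon> * real k<..slot_width \<rho> \<epsilon> * real (Suc k)}"
proof -
  have "slot_of \<rho> \<epsilon> s = Suc k \<longleftrightarrow> real k < s / slot_width \<rho> \<epsilon> \<and> s / slot_width \<rho> \<epsilon> \<le> real (Suc k)"
    unfolding slot_of_def by linarith
  then show ?thesis using assms by (simp add: field_simps)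
qed

text \<open>
  In macroscopic time a ring is used at about the time at which it happens, whatever the rate of its
  clock. All comparisons of slots for small \<open>\<epsilon>\<close> reduce to comparisons of these limits.
\<close>

lemma slot_of_scaled:
  assumes \<rho>: "0 \<le> \<rho>" and s: "0 < s"
  shows "((\<lambda>\<epsilon>. \<epsilon> * real (slot_of \<rho> \<epsilon> s)) \<longlongrightarrow> s) (at_right 0)"
proof (rule tendsto_sandwich)
  have "((\<lambda>\<epsilon>. s / (slot_width \<rho> \<epsilon> / \<epsilon>)) \<longlongrightarrow> s / 1) (at_right 0)"
    by (intro tendsto_intros slot_width_asymp \<rho>) simp
  then show lo: "((\<lambda>\<epsilon>. s / (slot_width \<rho> \<epsilon> / \<epsilon>)) \<longlongrightarrow> s) (at_right 0)" by simp
  have "((\<lambda>\<epsilon>. s / (slot_width \<rho> \<epsilon> / \<epsilon>) + \<epsilon>) \<longlongrightarrow> s + 0) (at_right 0)"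
    by (intro tendsto_add lo tendsto_ident_at)
  then show "((\<lambda>\<epsilon>. s / (slot_width \<rho> \<epsilon> / \<epsilon>) + \<epsilon>) \<longlongrightarrow> s) (at_right 0)" by simp
  have bounds: "s / w \<le> real (nat \<lceil>s / w\<rceil>)" "real (nat \<lceil>s / w\<rceil>) \<le> s / w + 1" if "0 < w" for w
    using divide_pos_pos[OF s that] by linarith+
  show "\<forall>\<^sub>F \<epsilon> in at_right 0. s / (slot_width \<rho> \<epsilon> / \<epsilon>) \<le> \<epsilon> * real (slot_of \<rho> \<epsilon> s)"
    using eventually_small[of \<rho>]
  proof eventually_elim
    case (elim \<epsilon>)
    then show ?case
      using mult_left_mono[OF bounds(1)[OF slot_width_pos[OF \<rho>]], of \<epsilon> \<epsilon>]
      by (simp add: slot_of_def mult.commute)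
  qed
  show "\<forall>\<^sub>F \<epsilon> in at_right 0. \<epsilon> * real (slot_of \<rho> \<epsilon> s) \<le> s / (slot_width \<rho> \<epsilon> / \<epsilon>) + \<epsilon>"
    using eventually_small[of \<rho>]
  proof eventually_elim
    case (elim \<epsilon>)
    then show ?case
      using mult_left_mono[OF bounds(2)[OF slot_width_pos[OF \<rho>]], of \<epsilon> \<epsilon>]
      by (simp add: slot_of_def algebra_simps)
  qed
qed

lemma floor_scaled:
  assumes "0 < t"
  shows "((\<lambda>\<epsilon>. \<epsilon> * real (nat \<lfloor>t / \<epsilon>\<rfloor>)) \<longlongrightarrow> t) (at_right 0)"
proof (rule tendsto_sandwich)
  have "((\<lambda>\<epsilon>. t - \<epsilon>) \<longlongrightarrow> t - 0) (at_right 0)" by (intro tendsto_intros)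
  then show "((\<lambda>\<epsilon>. t - \<epsilon>) \<longlongrightarrow> t) (at_right 0)" by simp
  have bounds: "t / \<epsilon> - 1 \<le> real (nat \<lfloor>t / \<epsilon>\<rfloor>)" "real (nat \<lfloor>t / \<epsilon>\<rfloor>) \<le> t / \<epsilon>" if "0 < \<epsilon>" for \<epsilon>
    using divide_pos_pos[OF assms that] by linarith+
  show "\<forall>\<^sub>F \<epsilon> in at_right 0. t - \<epsilon> \<le> \<epsilon> * real (nat \<lfloor>t / \<epsilon>\<rfloor>)"
    using eventually_at_right_less[of 0]
    by eventually_elim (use bounds(1) in \<open>auto simp: field_simps\<close>)
  show "\<forall>\<^sub>F \<epsilon> in at_right 0. \<epsilon> * real (nat \<lfloor>t / \<epsilon>\<rfloor>) \<le> t"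
    using eventually_at_right_less[of 0]
    by eventually_elim (use bounds(2) in \<open>auto simp: field_simps\<close>)
qed simp

section \<open>Almost sure agreement of the currents\<close>

context asep
begin

text \<open>
  Tags are coded by natural numbers in order to count them measurably.
\<close>

lemma asep_current_measurable:
  assumes "0 \<le> t"
  shows "(\<lambda>\<omega>. asep_current (\<lambda>i s. X i s \<omega>) t x) \<in> borel_measurable M"
proof -
  define A where "A \<omega> = {n. int_decode n \<in> right_crossers (\<lambda>i s. X i s \<omega>) t x}" for \<omega>
  define B where "B \<omega> = {n. int_decode n \<in> left_crossers (\<lambda>i s. X i s \<omega>) t x}" for \<omega>
  have pos: "Measurable.pred M (\<lambda>\<omega>. h (X i 0 \<omega>) (X i t \<omega>))" for h i
    by (rule measurable_discrete_pair[OF position_measurable[OF order_refl] position_measurable[OF assms]])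
  have [measurable]: "Measurable.pred M (\<lambda>\<omega>. n \<in> A \<omega>)" "Measurable.pred M (\<lambda>\<omega>. n \<in> B \<omega>)" for n
    using pos[of "\<lambda>u v. u \<noteq> None \<and> the u \<le> 0 \<and> the v > x" "int_decode n"]
      pos[of "\<lambda>u v. u \<noteq> None \<and> the u > 0 \<and> the v \<le> x" "int_decode n"]
    by (simp_all add: A_def B_def right_crossers_def left_crossers_def)
  have vimage: "finite {n. int_decode n \<in> S} \<longleftrightarrow> finite S" "card {n. int_decode n \<in> S} = card S" for S
    using finite_vimage_iff[OF bij_int_decode, of S] card_vimage_inj[OF inj_int_decode, of S]
    by (simp_all add: vimage_def surj_int_decode)
  have eq: "asep_current (\<lambda>i s. X i s \<omega>) t x =
      (if \<exists>m. \<forall>n. n \<in> A \<omega> \<or> n \<in> B \<omega> \<longrightarrow> n \<le> m then real (card (A \<omega>)) - real (card (B \<omega>)) else 0)" for \<omega>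
  proof -
    have "(\<exists>m. \<forall>n. n \<in> A \<omega> \<or> n \<in> B \<omega> \<longrightarrow> n \<le> m) \<longleftrightarrow> finite (A \<omega> \<union> B \<omega>)"
      by (auto simp: finite_nat_set_iff_bounded_le)
    then show ?thesis by (simp add: asep_current_eq A_def B_def vimage)
  qed
  have "(\<lambda>\<omega>. real (card (A \<omega>)) - real (card (B \<omega>))) \<in> borel_measurable M"
    by (intro borel_measurable_diff measurable_compose[OF measurable_card]) (simp_all add: pred_def[symmetric])
  moreover have "Measurable.pred M (\<lambda>\<omega>. \<exists>m. \<forall>n. n \<in> A \<omega> \<or> n \<in> B \<omega> \<longrightarrow> n \<le> m)"
    by measurable
  then have "{\<omega> \<in> space M. \<exists>m. \<forall>n. n \<in> A \<omega> \<or> n \<in> B \<omega> \<longrightarrow> n \<le> m} \<in> events"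
    by (simp only: pred_def)
  ultimately have "(\<lambda>\<omega>. if \<exists>m. \<forall>n. n \<in> A \<omega> \<or> n \<in> B \<omega> \<longrightarrow> n \<le> m
      then real (card (A \<omega>)) - real (card (B \<omega>)) else 0) \<in> borel_measurable M"
    by (intro measurable_If) simp_all
  with eq show ?thesis by (simp only:)
qed

definition clock_width :: "real \<Rightarrow> direction \<times> int \<Rightarrow> real" where
  "clock_width \<epsilon> q = slot_width (clock_rate q) \<epsilon>"

lemma six_vertex_prob:
  assumes "0 < \<epsilon>" "L * \<epsilon> < 1" "R * \<epsilon> < 1"
  shows "measure (six_vertex (\<epsilon> * L) (\<epsilon> * R) \<Phi>) {\<omega> \<in> space (six_vertex (\<epsilon> * L) (\<epsilon> * R) \<Phi>).
       r \<le> real_of_int (six_vertex_current \<omega> z k)}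
     = prob {\<omega> \<in> space M. r \<le> real_of_int (six_vertex_current (\<phi> \<omega>, vertex_coins (clock_width \<epsilon>) \<omega>) z k)}"
    and "{\<omega> \<in> space M. r \<le> real_of_int (six_vertex_current (\<phi> \<omega>, vertex_coins (clock_width \<epsilon>) \<omega>) z k)} \<in> events"
proof -
  let ?T = "\<lambda>\<omega>. (\<phi> \<omega>, vertex_coins (clock_width \<epsilon>) \<omega>)"
  let ?E = "{\<omega> \<in> space six_vertex_space. r \<le> real_of_int (six_vertex_current \<omega> z k)}"
  have small: "clock_rate q * \<epsilon> < 1" for q using assms by (simp add: clock_rate_def)
  have w: "0 \<le> clock_width \<epsilon> q" for q
    using slot_width_pos[OF clock_rate_nonneg assms(1) small, of q] by (simp add: clock_width_def)
  have eq: "distr M six_vertex_space ?T = six_vertex (\<epsilon> * L) (\<epsilon> * R) \<Phi>"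
    by (rule distr_coupling[of "clock_width \<epsilon>", OF w])
      (use exp_slot_width[of L \<epsilon>] exp_slot_width[of R \<epsilon>] assms in
        \<open>simp_all add: clock_width_def clock_rate_def\<close>)
  have T: "?T \<in> measurable M six_vertex_space"
    using initial_measurable vertex_coins_measurable[of "clock_width \<epsilon>", OF w] by measurable
  have "Measurable.pred six_vertex_space (\<lambda>\<omega>. r \<le> real_of_int (six_vertex_current \<omega> z k))"
    by (rule measurable_compose[OF six_vertex_current_measurable]) simp
  then have E: "?E \<in> sets six_vertex_space" by (simp add: pred_def)
  have pre: "?T -` ?E \<inter> space M =
      {\<omega> \<in> space M. r \<le> real_of_int (six_vertex_current (\<phi> \<omega>, vertex_coins (clock_width \<epsilon>) \<omega>) z k)}"
    using measurable_space[OF T] by auto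
  show "{\<omega> \<in> space M. r \<le> real_of_int (six_vertex_current (\<phi> \<omega>, vertex_coins (clock_width \<epsilon>) \<omega>) z k)} \<in> events"
    using measurable_sets[OF T E] unfolding pre .
  show "measure (six_vertex (\<epsilon> * L) (\<epsilon> * R) \<Phi>) {\<omega> \<in> space (six_vertex (\<epsilon> * L) (\<epsilon> * R) \<Phi>).
       r \<le> real_of_int (six_vertex_current \<omega> z k)}
     = prob {\<omega> \<in> space M. r \<le> real_of_int (six_vertex_current (\<phi> \<omega>, vertex_coins (clock_width \<epsilon>) \<omega>) z k)}"
    unfolding eq[symmetric] space_distr measure_distr[OF T E] pre ..
qed

text \<open>
  For almost every realization, choose quiet bonds on both sides of the origin and of \<open>x\<close>. Only
  finitely many rings up to time \<open>t + 1\<close> remain, so the finitely many conditions on their slots hold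
  simultaneously for small \<open>\<epsilon>\<close>. A ring after time \<open>t + 1\<close> is never used up to row \<open>\<lfloor>t / \<epsilon>\<rfloor>\<close>, as these
  rows consume the clocks only up to about time \<open>t\<close>.
\<close>

lemma eventually_currents_agree:
  assumes t: "0 < t"
  shows "AE \<omega> in M. \<forall>\<^sub>F \<epsilon> in at_right 0.
     real_of_int (six_vertex_current (\<phi> \<omega>, vertex_coins (clock_width \<epsilon>) \<omega>)
       (real_of_int (x + \<lfloor>t / \<epsilon>\<rfloor>)) (nat \<lfloor>t / \<epsilon>\<rfloor>))
     = asep_current (\<lambda>i s. X i s \<omega>) t x"
proof -
  have T: "0 \<le> t + 1" using t by simp
  show ?thesis
    using evolution AE_clock_locally_finite AE_rings_iff AE_no_simultaneous_rings AE_no_ring_at[OF t]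
      AE_quiet_bonds[OF T, of "min 0 x"] AE_quiet_bonds[OF T, of "max 0 x"]
  proof eventually_elim
    case (elim \<omega>)
    define n where "n q = N q \<omega>" for q
    have pos: "0 < s" if "s \<in> n q" for s q
      using elim(2) that unfolding n_def by blast
    have fin: "finite (n q \<inter> {0<..s})" for s q
      using elim(2) unfolding n_def by blast
    obtain a b where a: "a < min 0 x" "quiet_bond (t + 1) \<omega> a" and b: "b > max 0 x" "quiet_bond (t + 1) \<omega> b"
      using elim(6,7) by blast
    define Y where "Y \<epsilon> = nat \<lfloor>t / \<epsilon>\<rfloor>" for \<epsilon>
    define slot where "slot \<epsilon> q = slot_of (clock_rate q) \<epsilon>" for \<epsilon> q
    define E where "E = {(q, s). snd q \<in> {a..b+1} \<and> s \<in> n q \<and> s \<le> t + 1}"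
    have "finite E"
    proof (rule finite_subset)
      show "E \<subseteq> (SIGMA q:UNIV \<times> {a..b+1}. n q \<inter> {0<..t + 1})"
        using pos by (auto simp: E_def)
      show "finite (SIGMA q:UNIV \<times> {a..b+1}. n q \<inter> {0<..t + 1})"
        using fin by (intro finite_SigmaI finite_cartesian_product) (auto simp: UNIV_direction)
    qed
    have Y: "((\<lambda>\<epsilon>. \<epsilon> * real (Y \<epsilon>)) \<longlongrightarrow> t) (at_right 0)"
      using floor_scaled[OF t] by (simp add: Y_def)
    have slot: "((\<lambda>\<epsilon>. \<epsilon> * real (slot \<epsilon> q s)) \<longlongrightarrow> s) (at_right 0)" if "0 < s" for q s
      using slot_of_scaled[OF clock_rate_nonneg that] by (simp add: slot_def)
    \<comment> \<open>Quantities of order \<open>1 / \<epsilon>\<close> are compared through their rescaled limits.\<close>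
    have less: "\<forall>\<^sub>F \<epsilon> in at_right 0. f \<epsilon> < g \<epsilon>"
      if "((\<lambda>\<epsilon>. \<epsilon> * f \<epsilon>) \<longlongrightarrow> u) (at_right 0)" "((\<lambda>\<epsilon>. \<epsilon> * g \<epsilon>) \<longlongrightarrow> v) (at_right 0)" "u < v"
      for f g :: "real \<Rightarrow> real" and u v
    proof -
      have m: "u < (u + v) / 2" "(u + v) / 2 < v" using \<open>u < v\<close> by auto
      from order_tendstoD(2)[OF that(1) m(1)] order_tendstoD(1)[OF that(2) m(2)]
        eventually_at_right_less[of 0]
      show ?thesis
      proof eventually_elim
        case (elim \<epsilon>)
        from elim(1,2) have "\<epsilon> * f \<epsilon> < \<epsilon> * g \<epsilon>" by (rule less_trans)
        then show ?case using elim(3) by simp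
      qed
    qed
    have le_iff: "\<forall>\<^sub>F \<epsilon> in at_right 0. \<forall>(q, s)\<in>E. slot \<epsilon> q s \<le> Y \<epsilon> \<longleftrightarrow> s \<le> t"
      unfolding case_prod_unfold
    proof (intro eventually_ball_finite[OF \<open>finite E\<close>] ballI)
      fix qs assume "qs \<in> E"
      then obtain q s where qs: "qs = (q, s)" "s \<in> n q" by (auto simp: E_def)
      then have "s \<noteq> t" "0 < s" using elim(5) pos unfolding n_def by blast+
      show "\<forall>\<^sub>F \<epsilon> in at_right 0. slot \<epsilon> (fst qs) (snd qs) \<le> Y \<epsilon> \<longleftrightarrow> snd qs \<le> t"
      proof (cases "s < t")
        case True
        have "\<forall>\<^sub>F \<epsilon> in at_right 0. real (slot \<epsilon> q s) < real (Y \<epsilon>)"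
          by (rule less[OF slot Y]) (use True \<open>0 < s\<close> in auto)
        then show ?thesis by eventually_elim (use True qs in simp)
      next
        case False
        have "\<forall>\<^sub>F \<epsilon> in at_right 0. real (Y \<epsilon>) < real (slot \<epsilon> q s)"
          by (rule less[OF Y slot]) (use False \<open>0 < s\<close> \<open>s \<noteq> t\<close> in auto)
        then show ?thesis by eventually_elim (use False \<open>s \<noteq> t\<close> qs in simp)
      qed
    qed
    have mono: "\<forall>\<^sub>F \<epsilon> in at_right 0. \<forall>(q, s)\<in>E. \<forall>(q', s')\<in>E. s < s' \<longrightarrow> slot \<epsilon> q s < slot \<epsilon> q' s'"
      unfolding case_prod_unfold
    proof (intro eventually_ball_finite[OF \<open>finite E\<close>] ballI)
      fix e e' assume "e \<in> E" "e' \<in> E"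
      then obtain q s q' s' where e: "e = (q, s)" "e' = (q', s')" "0 < s" "0 < s'"
        using pos by (auto simp: E_def)
      show "\<forall>\<^sub>F \<epsilon> in at_right 0. snd e < snd e' \<longrightarrow> slot \<epsilon> (fst e) (snd e) < slot \<epsilon> (fst e') (snd e')"
      proof (cases "s < s'")
        case True
        have "\<forall>\<^sub>F \<epsilon> in at_right 0. real (slot \<epsilon> q s) < real (slot \<epsilon> q' s')"
          by (rule less[OF slot slot]) (use True e in auto)
        then show ?thesis by eventually_elim (simp add: e)
      qed (simp add: e)
    qed
    have to_0: "((\<lambda>\<epsilon>. \<epsilon> * c) \<longlongrightarrow> 0) (at_right 0)" for c :: real
      using tendsto_mult[OF tendsto_ident_at[of 0 "{0<..}"] tendsto_const[of c]] by simp
    have late: "\<forall>\<^sub>F \<epsilon> in at_right 0. \<forall>(q, s)\<in>E. - a < int (slot \<epsilon> q s)"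
      unfolding case_prod_unfold
    proof (intro eventually_ball_finite[OF \<open>finite E\<close>] ballI)
      fix e assume "e \<in> E"
      then obtain q s where e: "e = (q, s)" "0 < s" using pos by (auto simp: E_def)
      have "\<forall>\<^sub>F \<epsilon> in at_right 0. real_of_int (- a) < real (slot \<epsilon> q s)"
        by (rule less[OF to_0 slot]) (use e in auto)
      then show "\<forall>\<^sub>F \<epsilon> in at_right 0. - a < int (slot \<epsilon> (fst e) (snd e))"
      proof eventually_elim
        case (elim \<epsilon>)
        then have "- a < int (slot \<epsilon> q s)" by linarith
        then show ?case by (simp add: e(1))
      qed
    qed
    have xY: "\<forall>\<^sub>F \<epsilon> in at_right 0. real_of_int (- x) < real (Y \<epsilon>)"
      by (rule less[OF to_0 Y t])
    have horizon: "\<forall>\<^sub>F \<epsilon> in at_right 0. slot_width \<rho> \<epsilon> * real (Y \<epsilon>) < t + 1" if "0 \<le> \<rho>" for \<rho>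
    proof -
      have "((\<lambda>\<epsilon>. (slot_width \<rho> \<epsilon> / \<epsilon>) * (\<epsilon> * real (Y \<epsilon>))) \<longlongrightarrow> 1 * t) (at_right 0)"
        by (intro tendsto_mult slot_width_asymp that Y)
      then have "\<forall>\<^sub>F \<epsilon> in at_right 0. (slot_width \<rho> \<epsilon> / \<epsilon>) * (\<epsilon> * real (Y \<epsilon>)) < t + 1"
        by (rule order_tendstoD) simp
      then show ?thesis using eventually_at_right_less[of 0] by eventually_elim simp
    qed
    have "0 \<le> L" "0 \<le> R"
      using clock_rate_nonneg[of "(Leftward, 0)"] clock_rate_nonneg[of "(Rightward, 0)"]
      by (simp_all add: clock_rate_def)
    from le_iff mono late xY horizon[OF this(1)] horizon[OF this(2)]
      eventually_small[of L] eventually_small[of R]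
    show ?case
    proof eventually_elim
      case (elim \<epsilon>)
      have small: "0 < \<epsilon>" "clock_rate q * \<epsilon> < 1" for q using elim(7,8) by (auto simp: clock_rate_def)
      have w: "0 < slot_width (clock_rate q) \<epsilon>" for q
        using slot_width_pos[OF clock_rate_nonneg small] .
      have wY: "slot_width (clock_rate q) \<epsilon> * real (Y \<epsilon>) < t + 1" for q
        using elim(5,6) by (simp add: clock_rate_def)
      \<comment> \<open>This covers infinitely many rings at once, so it does not follow from limits ring by ring.\<close>
      have after: "\<not> slot \<epsilon> q s \<le> Y \<epsilon>" if "t + 1 < s" for q s
      proof -
        have "real (Y \<epsilon>) < s / slot_width (clock_rate q) \<epsilon>"
          using wY[of q] that w[of q] by (simp add: field_simps)
        then show ?thesis unfolding slot_def slot_of_def by linarith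
      qed
      have coin_iff: "coin (clock_width \<epsilon>) (q, k) \<omega> \<longleftrightarrow> (\<exists>s\<in>n q. slot \<epsilon> q s = Suc k)" for q k
      proof -
        have "0 \<le> clock_width \<epsilon> q * real k" "clock_width \<epsilon> q * real k \<le> clock_width \<epsilon> q * real (Suc k)"
          using w[of q] by (auto simp: clock_width_def)
        then have "coin (clock_width \<epsilon>) (q, k) \<omega> \<longleftrightarrow>
            N q \<omega> \<inter> {clock_width \<epsilon> q * real k<..clock_width \<epsilon> q * real (Suc k)} \<noteq> {}"
          using \<open>\<forall>q u v. 0 \<le> u \<longrightarrow> u \<le> v \<longrightarrow> (rings q u v \<omega> \<longleftrightarrow> N q \<omega> \<inter> {u<..v} \<noteq> {})\<close>
          unfolding coin_def prod.case by blast
        also have "\<dots> \<longleftrightarrow> (\<exists>s\<in>n q. slot \<epsilon> q s = Suc k)"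
          unfolding slot_def slot_of_eq_Suc_iff[OF w] by (auto simp: n_def clock_width_def)
        finally show ?thesis .
      qed
      have vertex: "vertex_coins (clock_width \<epsilon>) \<omega> (Suc m, Suc k) =
          (\<exists>s\<in>n (Leftward, int m - int k + 1). slot \<epsilon> (Leftward, int m - int k + 1) s = Suc k,
           \<exists>s\<in>n (Rightward, int m - int k). slot \<epsilon> (Rightward, int m - int k) s = Suc k)" for m k
        by (simp add: vertex_coins_def vertex_bond_def bond_coins_def coin_iff)
      interpret block_coupling "\<phi> \<omega>" n "\<lambda>i s. X i s \<omega>" "vertex_coins (clock_width \<epsilon>) \<omega>" "slot \<epsilon>" a b x t "Y \<epsilon>"
      proof
        show "graphical_asep n (initially_occupied (\<phi> \<omega>)) (\<lambda>i s. X i s \<omega>)"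
          using \<open>graphical_asep (\<lambda>c. N c \<omega>) (initially_occupied (\<phi> \<omega>)) (\<lambda>i s. X i s \<omega>)\<close>
          by (simp add: n_def[abs_def])
        show "0 \<le> t" using t by simp
        show "a < b" "a \<le> 0" "a \<le> x" "0 \<le> b" "x \<le> b" using a b by auto
        show "0 < s" if "s \<in> n q" for q s using pos that .
        show "finite (n q \<inter> {0<..s})" for q s by (rule fin)
        show "q = q'" if "s \<in> n q" "s \<in> n q'" for q q' s
          using \<open>\<forall>q q' s. s \<in> N q \<omega> \<longrightarrow> s \<in> N q' \<omega> \<longrightarrow> q = q'\<close> that unfolding n_def by blast
        show "t < s" if "e \<in> {a, b}" "q \<in> {(Rightward, e), (Leftward, e + 1)}" "s \<in> n q" for e q s
        proof -
          have "quiet_bond (t + 1) \<omega> e" using that(1) a b by auto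
          then have "n q \<inter> {0<..t + 1} = {}" using that(2) by (auto simp: quiet_bond_def n_def)
          then show ?thesis using that(3) pos[OF that(3)] by force
        qed
        show "slot \<epsilon> q s \<le> Y \<epsilon> \<longleftrightarrow> s \<le> t" if "snd q \<in> {a..b + 1}" "s \<in> n q" for q s
        proof (cases "s \<le> t + 1")
          case True
          then have "(q, s) \<in> E" using that by (simp add: E_def)
          then show ?thesis using elim(1) by auto
        next
          case False
          then show ?thesis using after[of s q] by simp
        qed
        show "slot \<epsilon> q s < slot \<epsilon> q' s'"
          if "snd q \<in> {a..b + 1}" "snd q' \<in> {a..b + 1}" "s \<in> n q" "s' \<in> n q'" "s < s'" "s' \<le> t" for q q' s s'
        proof -
          have "(q, s) \<in> E" "(q', s') \<in> E" using that by (simp_all add: E_def)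
          then show ?thesis using elim(2) that(5) by blast
        qed
        show "- a < int (slot \<epsilon> q s)" if "snd q \<in> {a..b + 1}" "s \<in> n q" "s \<le> t" for q s
        proof -
          have "(q, s) \<in> E" using that by (simp add: E_def)
          then show ?thesis using elim(3) by blast
        qed
      qed (rule vertex)
      have "int (Y \<epsilon>) = \<lfloor>t / \<epsilon>\<rfloor>" using t small(1) by (simp add: Y_def)
      moreover have "0 \<le> x + int (Y \<epsilon>)" using elim(4) by linarith
      ultimately show ?case using currents_agree by (simp add: Y_def)
    qed
  qed
qed

end

theorem corollary4:
  fixes R L r t :: real and x :: int
    and \<Phi> :: "(nat \<Rightarrow> bool \<times> bool) measure"
    and M :: "'w measure"
    and \<phi> :: "'w \<Rightarrow> nat \<Rightarrow> bool \<times> bool"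
    and N :: "direction \<times> int \<Rightarrow> 'w \<Rightarrow> real set"
    and X :: "int \<Rightarrow> real \<Rightarrow> 'w \<Rightarrow> int option"
  assumes "0 \<le> R" and "0 \<le> L" and "0 < t"
    and "prob_space \<Phi>" and "sets \<Phi> = sets data_space"
    and "asep M L R \<Phi> \<phi> N X"
  shows "((\<lambda>\<epsilon>. measure (six_vertex (\<epsilon> * L) (\<epsilon> * R) \<Phi>)
              {\<omega> \<in> space (six_vertex (\<epsilon> * L) (\<epsilon> * R) \<Phi>).
                 real_of_int (six_vertex_current \<omega> (real_of_int (x + \<lfloor>t / \<epsilon>\<rfloor>)) (nat \<lfloor>t / \<epsilon>\<rfloor>)) \<ge> r})
          \<longlongrightarrow> measure M {\<omega> \<in> space M. asep_current (\<lambda>i s. X i s \<omega>) t x \<ge> r}) (at_right 0)"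
proof -
  interpret asep M L R \<Phi> \<phi> N X by fact
  have "\<forall>\<^sub>F \<epsilon> in at_right 0. 0 < \<epsilon> \<and> L * \<epsilon> < 1 \<and> R * \<epsilon> < 1"
    using eventually_small[of L] eventually_small[of R] by eventually_elim simp
  then obtain d where d: "d > 0" "\<And>\<epsilon>. 0 < \<epsilon> \<Longrightarrow> \<epsilon> < d \<Longrightarrow> L * \<epsilon> < 1 \<and> R * \<epsilon> < 1"
    unfolding eventually_at_right_field by auto
  show ?thesis
  proof (rule tendsto_at_right_sequentially[OF d(1)])
    fix S :: "nat \<Rightarrow> real"
    assume S: "\<And>n. 0 < S n" "\<And>n. S n < d" "S \<longlonglongrightarrow> 0"
    have small: "0 < S n" "L * S n < 1" "R * S n < 1" for n using S d(2)[of "S n"] by auto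
    have S_right: "filterlim S (at_right 0) sequentially"
      using S(1,3) less_imp_neq[OF S(1)] by (auto simp: filterlim_at intro!: always_eventually)
    let ?J = "{\<omega> \<in> space M. asep_current (\<lambda>i s. X i s \<omega>) t x \<ge> r}"
    let ?H = "\<lambda>n. {\<omega> \<in> space M. r \<le> real_of_int (six_vertex_current
      (\<phi> \<omega>, vertex_coins (clock_width (S n)) \<omega>) (real_of_int (x + \<lfloor>t / S n\<rfloor>)) (nat \<lfloor>t / S n\<rfloor>))}"
    have "(\<lambda>n. prob (?H n)) \<longlonglongrightarrow> prob ?J"
    proof (rule prob_tendsto_if_AE_eventually)
      show "?H n \<in> events" for n by (rule six_vertex_prob(2)[OF small])
      show "?J \<in> events"
        using asep_current_measurable[of t x, OF less_imp_le[OF \<open>0 < t\<close>]] by measurable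
      show "AE \<omega> in M. \<forall>\<^sub>F n in sequentially. \<omega> \<in> ?H n \<longleftrightarrow> \<omega> \<in> ?J"
        using eventually_currents_agree[OF \<open>0 < t\<close>, of x]
      proof eventually_elim
        case (elim \<omega>)
        from eventually_compose_filterlim[OF this S_right] show ?case
          by eventually_elim simp
      qed
    qed
    then show "(\<lambda>n. measure (six_vertex (S n * L) (S n * R) \<Phi>)
              {\<omega> \<in> space (six_vertex (S n * L) (S n * R) \<Phi>).
                 real_of_int (six_vertex_current \<omega> (real_of_int (x + \<lfloor>t / S n\<rfloor>)) (nat \<lfloor>t / S n\<rfloor>)) \<ge> r})
          \<longlonglongrightarrow> prob ?J"
      by (simp only: six_vertex_prob(1)[OF small])
  qed
qed

end
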